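(* Let $\rho_1,\rho_2$ be sublinear expectations that are both continuous from above on $L_c^1$, let $\alpha\in(0,1)$, and assume that there is an optimal test, i.e. some $X_0\in\hat{\mathcal{X}}_\alpha$ with $\bar\rho_2(X_0)=\sup_{X\in\hat{\mathcal{X}}_\alpha}\bar\rho_2(X)$. Then there exist probability measures $Q$ and $P$ on $\mathcal{B}(\Omega)$ such that: (a) $E_Q[X]\le\rho_2(X)$ for all $X\in L_c^1$, and $\sup_{X\in\hat{\mathcal{X}}_\alpha}E_Q[X]=\sup_{X\in\hat{\mathcal{X}}_\alpha}\bar\rho_2(X)$; (b) $E_P[X]\le\rho_1(X)$ for all $X\in L_c^1$, and, writing $\gamma=\sup_{X\in\hat{\mathcal{X}}_\alpha}E_Q[X]$, if $E_Q[X]<\gamma$ for every $X\in\hat{\mathcal{X}}_\alpha$ with $\rho_1(X)<\alpha$, then $\inf_{Y\in\hat{\mathcal{Y}}}E_P[Y]=\inf_{Y\in\hat{\mathcal{Y}}}\rho_1(Y)$, where $\hat{\mathcal{Y}}=\{Y\in L_c^1:0\le Y\le1,\ E_Q[Y]\ge\gamma\}$; (c) every $X^*\in\hat{\mathcal{X}}_\alpha$ with $\bar\rho_2(X^* )=\sup_{X\in\hat{\mathcal{X}}_\alpha}\bar\rho_2(X)$ has the form $$X^*=I_{\{\kappa H_Q>G_P\}}+B\,I_{\{\kappa H_Q=G_P\}},\quad K\text{-a.s.},$$ for some $\kappa\in\mathbb{R}\cup\{+\infty\}$ and some random variable $B$ with values in $[0,1]$, where $K=\frac{P+Q}{2}$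 and $H_Q$, $G_P$ are the Radon-Nikodym derivatives of $Q$ and $P$ with respect to $K$. When $\kappa=+\infty$, the right-hand side is understood as $I_{\{H_Q>0\}}+B\,I_{\{H_Q=0\}}$.
   Context: $\Omega$ is a complete separable metric space with Borel $\sigma$-field $\mathcal{B}(\Omega)$, and $C_b(\Omega)$ is the set of bounded continuous real functions on $\Omega$. A sublinear expectation is a real-valued map $\rho$ on the bounded Borel functions that is monotone, constant preserving ($\rho(c)=c$), sub-additive and positively homogeneous ($\rho(\lambda\xi)=\lambda\rho(\xi)$ for $\lambda\ge0$); its conjugate is $\bar\rho(X)=-\rho(-X)$. Given $\rho_1,\rho_2$, put $\rho(X)=\rho_1(X)\vee\rho_2(X)$, which is again a sublinear expectation, and $c(A)=\rho(I_A)$. A set $A$ is polar if $c(A)=0$, and a property holds $c$-quasi-surely ($c$-q.s.) if it holds outside a polar set. $L_c^1$ is the completion of $C_b(\Omega)$ under the norm $\|X\|_{L^1}=\rho(|X|)$; its elements are regarded as functions up to q.s. equality, and $\rho_1,\rho_2,\bar\rho_2$ are extended to $L^1_c$ by continuity. $\hat{\mathcal{X}}_\alpha=\{X\in L_c^1: 0\le X\le1,\ \rho_1(X)\le\alpha\}$. A sublinear expectation $\rho'$ is continuous from above on $L_c^1$ if for every sequence $(f_n)\subset L_c^1$ with $f_n\downarrow0$ $c$-q.s. one has $\rho'(f_n)\downarrow0$. *)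

theory Defs
  imports "HOL-Probability.Probability"
begin

definition bounded_borel :: "('a::topological_space \<Rightarrow> real) set" where
  "bounded_borel = {X \<in> borel_measurable borel. bounded (range X)}"

text \<open>A functional on bounded Borel functions is a total function of type
  \<^typ>\<open>('a \<Rightarrow> real) \<Rightarrow> real\<close>; its values outside \<^term>\<open>bounded_borel\<close> are never used.\<close>

definition sublinear_expectation :: "(('a::topological_space \<Rightarrow> real) \<Rightarrow> real) \<Rightarrow> bool" where
  "sublinear_expectation \<rho> \<longleftrightarrow>
     (\<forall>X\<in>bounded_borel. \<forall>Y\<in>bounded_borel. (\<forall>\<omega>. X \<omega> \<le> Y \<omega>) \<longrightarrow> \<rho> X \<le> \<rho> Y) \<and>
     (\<forall>c. \<rho> (\<lambda>_. c) = c) \<and>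
     (\<forall>X\<in>bounded_borel. \<forall>Y\<in>bounded_borel. \<rho> (\<lambda>\<omega>. X \<omega> + Y \<omega>) \<le> \<rho> X + \<rho> Y) \<and>
     (\<forall>X\<in>bounded_borel. \<forall>l\<ge>0. \<rho> (\<lambda>\<omega>. l * X \<omega>) = l * \<rho> X)"

definition conjugate :: "(('a \<Rightarrow> real) \<Rightarrow> real) \<Rightarrow> ('a \<Rightarrow> real) \<Rightarrow> real" where
  "conjugate \<rho> X = - \<rho> (\<lambda>\<omega>. - X \<omega>)"

definition max_expectation ::
    "(('a \<Rightarrow> real) \<Rightarrow> real) \<Rightarrow> (('a \<Rightarrow> real) \<Rightarrow> real) \<Rightarrow> ('a \<Rightarrow> real) \<Rightarrow> real" where
  "max_expectation \<rho>\<^sub>1 \<rho>\<^sub>2 X = max (\<rho>\<^sub>1 X) (\<rho>\<^sub>2 X)"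

definition polar :: "(('a::topological_space \<Rightarrow> real) \<Rightarrow> real) \<Rightarrow> 'a set \<Rightarrow> bool" where
  "polar \<rho> A \<longleftrightarrow> A \<in> sets borel \<and> \<rho> (indicator A) = 0"

definition quasi_surely :: "(('a::topological_space \<Rightarrow> real) \<Rightarrow> real) \<Rightarrow> ('a \<Rightarrow> bool) \<Rightarrow> bool" where
  "quasi_surely \<rho> \<phi> \<longleftrightarrow> (\<exists>N. polar \<rho> N \<and> (\<forall>\<omega>. \<omega> \<notin> N \<longrightarrow> \<phi> \<omega>))"

text \<open>The norm \<open>\<rho>(|X|)\<close>. As \<open>\<rho>\<close> is given on bounded functions only, a possibly unbounded
  \<open>X\<close> is truncated; if \<open>X\<close> is bounded the supremum is attained and equals \<open>\<rho>(|X|)\<close>.\<close>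

definition L1_norm :: "(('a \<Rightarrow> real) \<Rightarrow> real) \<Rightarrow> ('a \<Rightarrow> real) \<Rightarrow> ereal" where
  "L1_norm \<rho> X = (SUP k::nat. ereal (\<rho> (\<lambda>\<omega>. min \<bar>X \<omega>\<bar> (real k))))"

definition Cb_approx ::
    "(('a::topological_space \<Rightarrow> real) \<Rightarrow> real) \<Rightarrow> (nat \<Rightarrow> 'a \<Rightarrow> real) \<Rightarrow> ('a \<Rightarrow> real) \<Rightarrow> bool" where
  "Cb_approx \<rho> f X \<longleftrightarrow>
     (\<forall>n. f n \<in> bcontfun) \<and> (\<lambda>n. L1_norm \<rho> (\<lambda>\<omega>. f n \<omega> - X \<omega>)) \<longlonglongrightarrow> 0"

text \<open>Elements of the completion are represented by Borel functions, namely by the norm limits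
  of sequences of bounded continuous functions. Representatives that agree quasi-surely are not
  identified: changing \<open>X\<close> on a polar set does not change \<^term>\<open>Cb_approx \<rho> f X\<close> when \<open>\<rho>\<close>
  is sublinear.\<close>

definition Lc1 :: "(('a::topological_space \<Rightarrow> real) \<Rightarrow> real) \<Rightarrow> ('a \<Rightarrow> real) set" where
  "Lc1 \<rho> = {X \<in> borel_measurable borel. \<exists>f. Cb_approx \<rho> f X}"

text \<open>Extension by continuity of \<open>\<phi>\<close> from the bounded continuous functions to \<^term>\<open>Lc1 \<rho>\<close>:
  the common limit of \<open>\<phi>\<close> along all approximating sequences. It exists and is unique when \<open>\<phi>\<close>
  is \<open>\<rho>\<^sub>1\<close>, \<open>\<rho>\<^sub>2\<close> or a conjugate of these and \<open>\<rho> = max_expectation \<rho>\<^sub>1 \<rho>\<^sub>2\<close>, since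
  then \<open>|\<phi>(f) - \<phi>(g)| \<le> \<rho>(|f - g|)\<close>.\<close>

definition Lc1_ext ::
    "(('a::topological_space \<Rightarrow> real) \<Rightarrow> real) \<Rightarrow> (('a \<Rightarrow> real) \<Rightarrow> real) \<Rightarrow> ('a \<Rightarrow> real) \<Rightarrow> real" where
  "Lc1_ext \<rho> \<phi> X = (THE l. \<forall>f. Cb_approx \<rho> f X \<longrightarrow> (\<lambda>n. \<phi> (f n)) \<longlonglongrightarrow> l)"

definition continuous_from_above ::
    "(('a::topological_space \<Rightarrow> real) \<Rightarrow> real) \<Rightarrow> (('a \<Rightarrow> real) \<Rightarrow> real) \<Rightarrow> bool" where
  "continuous_from_above \<rho> \<phi> \<longleftrightarrow>
     (\<forall>f. (\<forall>n. f n \<in> Lc1 \<rho>) \<and>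
          quasi_surely \<rho> (\<lambda>\<omega>. decseq (\<lambda>n. f n \<omega>) \<and> (\<lambda>n. f n \<omega>) \<longlonglongrightarrow> 0) \<longrightarrow>
          decseq (\<lambda>n. Lc1_ext \<rho> \<phi> (f n)) \<and> (\<lambda>n. Lc1_ext \<rho> \<phi> (f n)) \<longlonglongrightarrow> 0)"

definition randomized_tests :: "(('a::topological_space \<Rightarrow> real) \<Rightarrow> real) \<Rightarrow> ('a \<Rightarrow> real) set" where
  "randomized_tests \<rho> = {X \<in> Lc1 \<rho>. quasi_surely \<rho> (\<lambda>\<omega>. 0 \<le> X \<omega> \<and> X \<omega> \<le> 1)}"

definition level_tests ::
    "(('a::topological_space \<Rightarrow> real) \<Rightarrow> real) \<Rightarrow> (('a \<Rightarrow> real) \<Rightarrow> real) \<Rightarrow> real \<Rightarrow> ('a \<Rightarrow> real) set" where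
  "level_tests \<rho> \<rho>\<^sub>1 \<alpha> = {X \<in> randomized_tests \<rho>. Lc1_ext \<rho> \<rho>\<^sub>1 X \<le> \<alpha>}"

definition power_tests ::
    "(('a::topological_space \<Rightarrow> real) \<Rightarrow> real) \<Rightarrow> 'a measure \<Rightarrow> real \<Rightarrow> ('a \<Rightarrow> real) set" where
  "power_tests \<rho> Q \<gamma> = {Y \<in> randomized_tests \<rho>. integral\<^sup>L Q Y \<ge> \<gamma>}"

definition mean_measure :: "'a::topological_space measure \<Rightarrow> 'a measure \<Rightarrow> 'a measure" where
  "mean_measure P Q = measure_of UNIV (sets borel) (\<lambda>A. (emeasure P A + emeasure Q A) / 2)"

text \<open>The case \<open>\<kappa> = \<infinity>\<close> is separate because \<open>\<infinity> * 0 = 0\<close> in \<^typ>\<open>ereal\<close> would give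
  the set \<open>{H = 0 \<and> G = 0}\<close> instead of \<open>{H = 0}\<close>.\<close>

definition threshold_test ::
    "ereal \<Rightarrow> ('a \<Rightarrow> real) \<Rightarrow> ('a \<Rightarrow> real) \<Rightarrow> ('a \<Rightarrow> real) \<Rightarrow> 'a \<Rightarrow> real" where
  "threshold_test \<kappa> H G B \<omega> =
     (if \<kappa> = \<infinity>
      then indicator {\<omega>. H \<omega> > 0} \<omega> + B \<omega> * indicator {\<omega>. H \<omega> = 0} \<omega>
      else indicator {\<omega>. real_of_ereal \<kappa> * H \<omega> > G \<omega>} \<omega>
           + B \<omega> * indicator {\<omega>. real_of_ereal \<kappa> * H \<omega> = G \<omega>} \<omega>)"

end

(* Both measures come from one construction. A level bound "s <= ext Y on a convex set C" can be
   separated by Hahn-Banach: there is a linear functional E on Lc1 with E <= ext that still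
   satisfies s <= E on C, and continuity from above turns E into an integral (Daniell-Stone).
   For Q take C = - T and s = - beta, where beta is the maximal worst-case power; this plays the role
   of a minimax theorem. For P take C = tests with Q-power at least beta, and s the minimal rho1-level
   of such tests. Now let X be optimal, so that E_Q X = beta. If beta = 1 then X = 1 Q-a.s. and
   kappa = infinity works. If beta < 1, mixing with the constant test 1 shows that s = alpha, so X
   minimises E_P among tests of Q-power at least beta; a Lagrange multiplier kappa then makes X a
   minimiser of E_P - kappa E_Q over continuous, hence over all Borel tests, and comparison with
   the indicator of {kappa H > G} gives the threshold form. *)

theory Submission
  imports Defs
begin

section \<open>Separation by linear functionals below a sublinear one\<close>

text \<open>Why \<open>Q\<close> replaces a minimax argument: domination applied at
  \<open>- X\<close> says that the conjugate of \<open>\<rho>\<^sub>2\<close> lies below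
  \<open>E_Q\<close>, and separation says that \<open>E_Q\<close> stays below \<beta> on
  \<open>T\<close>. Squeezed between the two, the suprema agree and every optimal test has
  \<open>Q\<close>-power exactly \<beta>; no compactness of the set of dominated measures is
  invoked. A finite multiplier needs tests of \<open>Q\<close>-power strictly on both sides of
  \<beta>. The constant tests 0 and 1 serve, since \<beta> \<ge> \<alpha> > 0, unless \<beta> = 1;
  that is the origin of the case \<kappa> = \<infinity>. The obstacle at the end is that the
  indicator of \<open>{\<kappa> H > G}\<close> need not be quasi-continuous, so it is not an
  admissible competitor. Only two finite Borel measures on a Polish space are involved there, and
  regularity lets continuous tests approach it in both L1 norms at once. Elements of
  \<open>Lc1\<close> are genuine functions, not classes, so the linear algebra is done on a set
  \<open>V\<close> of functions.\<close>

definition function_space :: "('a \<Rightarrow> real) set \<Rightarrow> bool" where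
  "function_space V \<longleftrightarrow> V \<noteq> {} \<and> (\<forall>x\<in>V. \<forall>y\<in>V. (\<lambda>\<omega>. x \<omega> + y \<omega>) \<in> V) \<and>
     (\<forall>x\<in>V. \<forall>t. (\<lambda>\<omega>. t * x \<omega>) \<in> V)"

lemma function_space_add: "function_space V \<Longrightarrow> x \<in> V \<Longrightarrow> y \<in> V \<Longrightarrow> (\<lambda>\<omega>. x \<omega> + y \<omega>) \<in> V"
  and function_space_scale: "function_space V \<Longrightarrow> x \<in> V \<Longrightarrow> (\<lambda>\<omega>. t * x \<omega>) \<in> V"
  by (auto simp: function_space_def)

lemma function_space_uminus: "function_space V \<Longrightarrow> x \<in> V \<Longrightarrow> (\<lambda>\<omega>. - x \<omega>) \<in> V"
  using function_space_scale[of V x "-1"] by simp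

lemma function_space_diff:
  "function_space V \<Longrightarrow> x \<in> V \<Longrightarrow> y \<in> V \<Longrightarrow> (\<lambda>\<omega>. x \<omega> - y \<omega>) \<in> V"
  using function_space_add[of V x "\<lambda>\<omega>. - y \<omega>"] function_space_uminus[of V y] by simp

lemma function_space_zero: "function_space V \<Longrightarrow> (\<lambda>_. 0) \<in> V"
  using function_space_scale[of V _ 0] by (auto simp: function_space_def)

text \<open>Demanding homogeneity only as an inequality loses nothing: equality follows by
  rescaling and subadditivity.\<close>

definition sublinear_on :: "('a \<Rightarrow> real) set \<Rightarrow> (('a \<Rightarrow> real) \<Rightarrow> real) \<Rightarrow> bool" where
  "sublinear_on V p \<longleftrightarrow> (\<forall>x\<in>V. \<forall>y\<in>V. p (\<lambda>\<omega>. x \<omega> + y \<omega>) \<le> p x + p y) \<and>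
     (\<forall>x\<in>V. \<forall>t\<ge>0. p (\<lambda>\<omega>. t * x \<omega>) \<le> t * p x)"

definition linear_on_functions :: "('a \<Rightarrow> real) set \<Rightarrow> (('a \<Rightarrow> real) \<Rightarrow> real) \<Rightarrow> bool" where
  "linear_on_functions V E \<longleftrightarrow> (\<forall>x\<in>V. \<forall>y\<in>V. E (\<lambda>\<omega>. x \<omega> + y \<omega>) = E x + E y) \<and>
     (\<forall>x\<in>V. \<forall>t. E (\<lambda>\<omega>. t * x \<omega>) = t * E x)"

definition convex_functions :: "('a \<Rightarrow> real) set \<Rightarrow> bool" where
  "convex_functions C \<longleftrightarrow>
     (\<forall>x\<in>C. \<forall>y\<in>C. \<forall>u v. 0 \<le> u \<longrightarrow> 0 \<le> v \<longrightarrow> u + v = 1 \<longrightarrow> (\<lambda>\<omega>. u * x \<omega> + v * y \<omega>) \<in> C)"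

lemma sublinear_on_add:
  "sublinear_on V p \<Longrightarrow> x \<in> V \<Longrightarrow> y \<in> V \<Longrightarrow> p (\<lambda>\<omega>. x \<omega> + y \<omega>) \<le> p x + p y"
  by (auto simp: sublinear_on_def)

lemma sublinear_on_scale_le:
  "sublinear_on V p \<Longrightarrow> x \<in> V \<Longrightarrow> 0 \<le> t \<Longrightarrow> p (\<lambda>\<omega>. t * x \<omega>) \<le> t * p x"
  by (auto simp: sublinear_on_def)

lemma sublinear_on_zero:
  assumes "function_space V" "sublinear_on V p"
  shows "p (\<lambda>_. 0) = 0"
  using sublinear_on_add[OF assms(2) function_space_zero[OF assms(1)] function_space_zero[OF assms(1)]]
    sublinear_on_scale_le[OF assms(2) function_space_zero[OF assms(1)], of 0] by simp

lemma sublinear_on_scale: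
  assumes V: "function_space V" and p: "sublinear_on V p" and x: "x \<in> V" and t: "0 \<le> t"
  shows "p (\<lambda>\<omega>. t * x \<omega>) = t * p x"
proof (cases "t = 0")
  case True
  then show ?thesis using sublinear_on_zero[OF V p] by simp
next
  case False
  then have "p x \<le> (1/t) * p (\<lambda>\<omega>. t * x \<omega>)"
    using sublinear_on_scale_le[OF p function_space_scale[OF V x, of t], of "1/t"] t by simp
  then have "t * p x \<le> p (\<lambda>\<omega>. t * x \<omega>)" using False t by (simp add: field_simps)
  then show ?thesis using sublinear_on_scale_le[OF p x t] by simp
qed

lemma sublinear_on_ge_neg:
  assumes V: "function_space V" and p: "sublinear_on V p" and x: "x \<in> V"
  shows "- p (\<lambda>\<omega>. - x \<omega>) \<le> p x"
  using sublinear_on_add[OF p x function_space_uminus[OF V x]] sublinear_on_zero[OF V p] by simp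

text \<open>Take the infimum of \<open>p (x + t y) - t s\<close> over \<open>t \<ge> 0\<close> and
  \<open>y \<in> C\<close>. The hypothesis \<open>s \<le> p\<close> on \<open>C\<close> keeps it
  above \<open>- p (- x)\<close>, hence finite; \<open>t = 0\<close> gives \<open>q \<le> p\<close>
  and \<open>t = 1\<close> the last claim. Applied to the given convex set, and again to singletons
  to obtain additivity.\<close>

lemma sublinear_on_decrease:
  assumes V: "function_space V" and p: "sublinear_on V p"
    and C: "C \<subseteq> V" "C \<noteq> {}" "convex_functions C" and s: "\<And>y. y \<in> C \<Longrightarrow> s \<le> p y"
  shows "\<exists>q. sublinear_on V q \<and> (\<forall>x\<in>V. q x \<le> p x) \<and>
    (\<forall>x\<in>V. \<forall>y\<in>C. q x \<le> p (\<lambda>\<omega>. x \<omega> + y \<omega>) - s)"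
proof -
  define S where "S x = {p (\<lambda>\<omega>. x \<omega> + t * y \<omega>) - t * s |t y. 0 \<le> t \<and> y \<in> C}" for x
  define q where "q x = Inf (S x)" for x
  have ne: "S x \<noteq> {}" for x using C(2) unfolding S_def by blast
  have lb: "- p (\<lambda>\<omega>. - x \<omega>) \<le> p (\<lambda>\<omega>. x \<omega> + t * y \<omega>) - t * s"
    if "x \<in> V" "0 \<le> t" "y \<in> C" for x t y
  proof -
    have y: "y \<in> V" using that C by auto
    have "t * s \<le> t * p y" using s that by (simp add: mult_left_mono)
    also have "\<dots> = p (\<lambda>\<omega>. t * y \<omega>)" using sublinear_on_scale[OF V p y \<open>0 \<le> t\<close>] by simp
    also have "\<dots> \<le> p (\<lambda>\<omega>. x \<omega> + t * y \<omega>) + p (\<lambda>\<omega>. - x \<omega>)"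
      using sublinear_on_add[OF p function_space_add[OF V \<open>x \<in> V\<close> function_space_scale[OF V y, of t]]
        function_space_uminus[OF V \<open>x \<in> V\<close>]] by simp
    finally show ?thesis by simp
  qed
  have bdd: "bdd_below (S x)" if "x \<in> V" for x
    unfolding bdd_below_def S_def using lb[OF that] by blast
  have q_le: "q x \<le> p (\<lambda>\<omega>. x \<omega> + t * y \<omega>) - t * s" if "x \<in> V" "0 \<le> t" "y \<in> C" for x t y
    unfolding q_def by (rule cInf_lower[OF _ bdd]) (use that in \<open>auto simp: S_def\<close>)
  have q_greatest: "z \<le> q x" if "\<And>t y. 0 \<le> t \<Longrightarrow> y \<in> C \<Longrightarrow> z \<le> p (\<lambda>\<omega>. x \<omega> + t * y \<omega>) - t * s" for z x
    unfolding q_def by (rule cInf_greatest[OF ne]) (use that in \<open>auto simp: S_def\<close>)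
  obtain y0 where y0: "y0 \<in> C" using C by auto
  have "sublinear_on V q"
    unfolding sublinear_on_def
  proof (intro conjI ballI allI impI)
    fix x x' assume x: "x \<in> V" "x' \<in> V"
    have *: "q (\<lambda>\<omega>. x \<omega> + x' \<omega>) \<le> (p (\<lambda>\<omega>. x \<omega> + t * y \<omega>) - t * s) + (p (\<lambda>\<omega>. x' \<omega> + t' * y' \<omega>) - t' * s)"
      if t: "0 \<le> t" "0 \<le> t'" and y: "y \<in> C" "y' \<in> C" for t t' y y'
    proof -
      have sum: "p (\<lambda>\<omega>. (x \<omega> + t * y \<omega>) + (x' \<omega> + t' * y' \<omega>))
          \<le> p (\<lambda>\<omega>. x \<omega> + t * y \<omega>) + p (\<lambda>\<omega>. x' \<omega> + t' * y' \<omega>)"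
        using C y by (intro sublinear_on_add[OF p] function_space_add[OF V] function_space_scale[OF V] x) auto
      \<comment> \<open>Convexity makes the cone over \<open>C\<close> closed under sums:
        \<open>t y + t' y'\<close> is \<open>t + t'\<close> times a convex combination. When
        \<open>t + t' = 0\<close> any element of \<open>C\<close> will do.\<close>
      have "\<exists>w\<in>C. \<forall>\<omega>. (t + t') * w \<omega> = t * y \<omega> + t' * y' \<omega>"
      proof (cases "t + t' = 0")
        case True
        then have "t = 0" "t' = 0" using t by auto
        then show ?thesis using y0 by auto
      next
        case False
        have "(\<lambda>\<omega>. t / (t + t') * y \<omega> + t' / (t + t') * y' \<omega>) \<in> C"
          using C(3) y t False unfolding convex_functions_def
          by (metis add_divide_distrib add_nonneg_nonneg divide_nonneg_nonneg divide_self)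
        then show ?thesis using False by (intro bexI[rotated]) (auto simp: distrib_left)
      qed
      then obtain w where w: "w \<in> C" "\<And>\<omega>. (t + t') * w \<omega> = t * y \<omega> + t' * y' \<omega>" by blast
      have "q (\<lambda>\<omega>. x \<omega> + x' \<omega>) \<le> p (\<lambda>\<omega>. (x \<omega> + x' \<omega>) + (t + t') * w \<omega>) - (t + t') * s"
        using t w by (intro q_le function_space_add[OF V] x) auto
      then show ?thesis using sum unfolding w(2) by (simp add: algebra_simps)
    qed
    have "q (\<lambda>\<omega>. x \<omega> + x' \<omega>) - (p (\<lambda>\<omega>. x' \<omega> + t' * y' \<omega>) - t' * s) \<le> q x"
      if "0 \<le> t'" "y' \<in> C" for t' y'
      by (rule q_greatest) (use *[of _ t' _ y'] that in \<open>simp add: algebra_simps\<close>)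
    note le = this
    have "q (\<lambda>\<omega>. x \<omega> + x' \<omega>) - q x \<le> p (\<lambda>\<omega>. x' \<omega> + t' * y' \<omega>) - t' * s"
      if "0 \<le> t'" "y' \<in> C" for t' y'
      using le[OF that] by linarith
    then have "q (\<lambda>\<omega>. x \<omega> + x' \<omega>) - q x \<le> q x'" by (intro q_greatest)
    then show "q (\<lambda>\<omega>. x \<omega> + x' \<omega>) \<le> q x + q x'" by simp
  next
    fix x and t :: real assume x: "x \<in> V" and t: "0 \<le> t"
    show "q (\<lambda>\<omega>. t * x \<omega>) \<le> t * q x"
    proof (cases "t = 0")
      case True
      then show ?thesis
        using q_le[OF function_space_zero[OF V] order_refl y0] sublinear_on_zero[OF V p] by simp
    next
      case False
      have "q (\<lambda>\<omega>. t * x \<omega>) / t \<le> q x"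
      proof (rule q_greatest)
        fix r :: real and y assume r: "0 \<le> r" "y \<in> C"
        have "q (\<lambda>\<omega>. t * x \<omega>) \<le> p (\<lambda>\<omega>. t * x \<omega> + (t * r) * y \<omega>) - (t * r) * s"
          using r t by (intro q_le function_space_scale[OF V] x) auto
        also have "(\<lambda>\<omega>. t * x \<omega> + (t * r) * y \<omega>) = (\<lambda>\<omega>. t * (x \<omega> + r * y \<omega>))"
          by (simp add: algebra_simps)
        also have "p \<dots> = t * p (\<lambda>\<omega>. x \<omega> + r * y \<omega>)"
          using C r by (intro sublinear_on_scale[OF V p _ t] function_space_add[OF V x] function_space_scale[OF V]) auto
        finally show "q (\<lambda>\<omega>. t * x \<omega>) / t \<le> p (\<lambda>\<omega>. x \<omega> + r * y \<omega>) - r * s"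
          using False t by (simp add: field_simps)
      qed
      then show ?thesis using False t by (simp add: field_simps)
    qed
  qed
  moreover have "q x \<le> p x" if "x \<in> V" for x using q_le[OF that order_refl y0] by simp
  moreover have "q x \<le> p (\<lambda>\<omega>. x \<omega> + y \<omega>) - s" if "x \<in> V" "y \<in> C" for x y
    using q_le[OF that(1) zero_le_one that(2)] by simp
  ultimately show ?thesis by (intro exI[of _ q]) simp
qed

text \<open>Zorn's lemma: every sublinear \<open>a \<le> p\<close> satisfies
  \<open>- p (- x) \<le> a x\<close>, so a chain has a finite pointwise infimum, and that infimum is
  again sublinear.\<close>

lemma minimal_sublinear_exists:
  assumes V: "function_space V" and p: "sublinear_on V p"
  shows "\<exists>q. sublinear_on V q \<and> (\<forall>x\<in>V. q x \<le> p x) \<and>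
    (\<forall>r. sublinear_on V r \<longrightarrow> (\<forall>x\<in>V. r x \<le> q x) \<longrightarrow> (\<forall>x\<in>V. r x = q x))"
proof -
  \<comment> \<open>Values off \<open>V\<close> are pinned to 0, so that agreement on
    \<open>V\<close> is equality of functions, as antisymmetry and minimality require.\<close>
  define A where "A = {q. sublinear_on V q \<and> (\<forall>x\<in>V. q x \<le> p x) \<and> (\<forall>x. x \<notin> V \<longrightarrow> q x = 0)}"
  \<comment> \<open>The order is reversed because \<open>predicate_Zorn\<close> delivers maximal
    elements.\<close>
  let ?P = "\<lambda>a b :: ('a \<Rightarrow> real) \<Rightarrow> real. b \<le> a"
  have po: "partial_order_on A (relation_of ?P A)"
    by (rule partial_order_on_relation_ofI) auto
  have restrict: "(\<lambda>x. if x \<in> V then r x else 0) \<in> A"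
    if "sublinear_on V r" "\<And>x. x \<in> V \<Longrightarrow> r x \<le> p x" for r
    using that by (auto simp: A_def sublinear_on_def function_space_add[OF V] function_space_scale[OF V])
  have ch: "\<exists>u\<in>A. \<forall>a\<in>K. ?P a u" if K: "K \<in> Chains (relation_of ?P A)" for K
  proof (cases "K = {}")
    case True
    have "(\<lambda>x. if x \<in> V then p x else 0) \<in> A" using p by (intro restrict) auto
    then show ?thesis using True by auto
  next
    case False
    have KA: "K \<subseteq> A" and tot: "\<And>a b. a \<in> K \<Longrightarrow> b \<in> K \<Longrightarrow> a \<le> b \<or> b \<le> a"
      using K unfolding Chains_def relation_of_def by auto
    have KD: "sublinear_on V a" "\<And>x. x \<in> V \<Longrightarrow> a x \<le> p x" "\<And>x. x \<notin> V \<Longrightarrow> a x = 0"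
      if "a \<in> K" for a using that KA by (auto simp: A_def)
    have bdd: "bdd_below ((\<lambda>a. a x) ` K)" for x
    proof (cases "x \<in> V")
      case True
      have "- p (\<lambda>\<omega>. - x \<omega>) \<le> a x" if "a \<in> K" for a
        using sublinear_on_ge_neg[OF V KD(1)[OF that] True]
          KD(2)[OF that function_space_uminus[OF V True]] by simp
      then show ?thesis by (intro bdd_belowI2)
    next
      case False
      show ?thesis by (intro bdd_belowI2[of _ 0]) (use KD(3)[OF _ False] in force)
    qed
    define u where "u x = (INF a\<in>K. a x)" for x
    have u_le: "u x \<le> a x" if "a \<in> K" for a x
      unfolding u_def by (rule cINF_lower[OF bdd that])
    have u_greatest: "z \<le> u x" if "\<And>a. a \<in> K \<Longrightarrow> z \<le> a x" for z x
      unfolding u_def by (rule cINF_greatest[OF False that])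
    have "sublinear_on V u"
      unfolding sublinear_on_def
    proof (intro conjI ballI allI impI)
      fix x y assume xy: "x \<in> V" "y \<in> V"
      have "u (\<lambda>\<omega>. x \<omega> + y \<omega>) \<le> a x + b y" if ab: "a \<in> K" "b \<in> K" for a b
      proof -
        \<comment> \<open>In a chain, one member lies below both \<open>a\<close> and
          \<open>b\<close>; its subadditivity passes to the infimum.\<close>
        obtain c where c: "c \<in> K" "c \<le> a" "c \<le> b" using tot[OF ab] ab by auto
        have "u (\<lambda>\<omega>. x \<omega> + y \<omega>) \<le> c x + c y"
          using u_le[OF c(1)] sublinear_on_add[OF KD(1)[OF c(1)] xy] by (rule order_trans)
        also have "\<dots> \<le> a x + b y" using c by (intro add_mono) (auto simp: le_fun_def)
        finally show ?thesis .
      qed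
      then have "u (\<lambda>\<omega>. x \<omega> + y \<omega>) - b y \<le> u x" if "b \<in> K" for b
        using that by (intro u_greatest) (simp add: algebra_simps)
      then have "u (\<lambda>\<omega>. x \<omega> + y \<omega>) - u x \<le> u y"
        by (intro u_greatest) (simp add: algebra_simps)
      then show "u (\<lambda>\<omega>. x \<omega> + y \<omega>) \<le> u x + u y" by simp
    next
      fix x and t :: real assume x: "x \<in> V" and t: "0 \<le> t"
      obtain a0 where a0: "a0 \<in> K" using False by auto
      show "u (\<lambda>\<omega>. t * x \<omega>) \<le> t * u x"
      proof (cases "t = 0")
        case True
        then show ?thesis
          using u_le[OF a0, of "\<lambda>_. 0"] sublinear_on_zero[OF V KD(1)[OF a0]] by simp
      next
        case nz: False
        have "u (\<lambda>\<omega>. t * x \<omega>) / t \<le> u x"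
        proof (rule u_greatest)
          fix a assume a: "a \<in> K"
          show "u (\<lambda>\<omega>. t * x \<omega>) / t \<le> a x"
            using order_trans[OF u_le[OF a] sublinear_on_scale_le[OF KD(1)[OF a] x t]] nz t
            by (simp add: field_simps)
        qed
        then show ?thesis using nz t by (simp add: field_simps)
      qed
    qed
    moreover obtain a0 where a0: "a0 \<in> K" using False by auto
    moreover have "u x = 0" if "x \<notin> V" for x
      using u_le[OF a0, of x] u_greatest[of 0 x] KD(3)[OF _ that] a0 by force
    ultimately have "u \<in> A"
      using order_trans[OF u_le[OF a0] KD(2)[OF a0]] by (auto simp: A_def)
    then show ?thesis using u_le by (auto simp: le_fun_def)
  qed
  obtain q where q: "q \<in> A" "\<And>a. a \<in> A \<Longrightarrow> a \<le> q \<Longrightarrow> a = q"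
    using predicate_Zorn[OF po ch] by blast
  show ?thesis
  proof (intro exI[of _ q] conjI allI impI ballI)
    show "sublinear_on V q" "\<And>x. x \<in> V \<Longrightarrow> q x \<le> p x" using q(1) by (auto simp: A_def)
    fix r x assume r: "sublinear_on V r" "\<forall>x\<in>V. r x \<le> q x" and x: "x \<in> V"
    have "(\<lambda>x. if x \<in> V then r x else 0) = q"
      using q(1) r by (intro q(2) restrict) (auto simp: A_def le_fun_def intro: order_trans)
    then show "r x = q x" using x by (auto dest: fun_cong[of _ _ x])
  qed
qed

text \<open>A minimal sublinear functional \<open>q\<close> is additive: otherwise
  \<open>y \<mapsto> inf\<^sub>t (q (y + t x) - t q x)\<close> would be a strictly smaller one.\<close>

theorem hahn_banach_convex_set:
  assumes V: "function_space V" and p: "sublinear_on V p"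
    and C: "C \<subseteq> V" "C \<noteq> {}" "convex_functions C" and s: "\<And>y. y \<in> C \<Longrightarrow> s \<le> p y"
  shows "\<exists>E. linear_on_functions V E \<and> (\<forall>x\<in>V. E x \<le> p x) \<and> (\<forall>y\<in>C. s \<le> E y)"
proof -
  \<comment> \<open>The constraint is built in before linearising:
    \<open>p' (- y) \<le> p 0 - s = - s\<close> for \<open>y \<in> C\<close>, so any linear
    functional below \<open>p'\<close> is at least \<open>s\<close> on \<open>C\<close>.\<close>
  have "\<exists>p'. sublinear_on V p' \<and> (\<forall>x\<in>V. p' x \<le> p x) \<and>
      (\<forall>x\<in>V. \<forall>y\<in>C. p' x \<le> p (\<lambda>\<omega>. x \<omega> + y \<omega>) - s)"
    by (rule sublinear_on_decrease[OF V p C s])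
  then obtain p' where p': "sublinear_on V p'" "\<forall>x\<in>V. p' x \<le> p x"
      "\<forall>x\<in>V. \<forall>y\<in>C. p' x \<le> p (\<lambda>\<omega>. x \<omega> + y \<omega>) - s"
    by (elim exE conjE)
  from minimal_sublinear_exists[OF V p'(1)]
  obtain q where q: "sublinear_on V q" "\<forall>x\<in>V. q x \<le> p' x"
    "\<forall>r. sublinear_on V r \<longrightarrow> (\<forall>x\<in>V. r x \<le> q x) \<longrightarrow> (\<forall>x\<in>V. r x = q x)"
    by (elim exE conjE)
  have add: "q (\<lambda>\<omega>. y \<omega> + x \<omega>) = q y + q x" if xy: "x \<in> V" "y \<in> V" for x y
  proof -
    have "convex_functions {x}"
      unfolding convex_functions_def by (simp flip: distrib_right)
    then have "\<exists>r. sublinear_on V r \<and> (\<forall>z\<in>V. r z \<le> q z) \<and>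
        (\<forall>z\<in>V. \<forall>y\<in>{x}. r z \<le> q (\<lambda>\<omega>. z \<omega> + y \<omega>) - q x)"
      by (intro sublinear_on_decrease[OF V q(1)]) (use xy in auto)
    then obtain r where r: "sublinear_on V r" "\<forall>z\<in>V. r z \<le> q z"
        "\<forall>z\<in>V. \<forall>y\<in>{x}. r z \<le> q (\<lambda>\<omega>. z \<omega> + y \<omega>) - q x"
      by (elim exE conjE)
    then have "q y \<le> q (\<lambda>\<omega>. y \<omega> + x \<omega>) - q x"
      using q(3)[rule_format, OF r(1) r(2)[rule_format] xy(2)]
        bspec[OF r(3) xy(2)] by simp
    then show ?thesis using sublinear_on_add[OF q(1) xy(2,1)] by simp
  qed
  have minus: "q (\<lambda>\<omega>. - x \<omega>) = - q x" if "x \<in> V" for x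
    using add[OF that function_space_uminus[OF V that]] sublinear_on_zero[OF V q(1)] by simp
  have scale: "q (\<lambda>\<omega>. t * x \<omega>) = t * q x" if x: "x \<in> V" for t x
  proof (cases "0 \<le> t")
    case True
    then show ?thesis by (rule sublinear_on_scale[OF V q(1) x])
  next
    case False
    then show ?thesis
      using sublinear_on_scale[OF V q(1) x, of "- t"] minus[OF function_space_scale[OF V x, of "-t"]]
      by simp
  qed
  show ?thesis
  proof (intro exI[of _ q] conjI ballI)
    show "linear_on_functions V q"
      unfolding linear_on_functions_def using add scale by blast
    show "q x \<le> p x" if "x \<in> V" for x using q(2) p'(2) that by force
    fix y assume y: "y \<in> C"
    then have yV: "y \<in> V" using C by auto
    have "q (\<lambda>\<omega>. - y \<omega>) \<le> p (\<lambda>_. 0) - s"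
      using bspec[OF q(2) function_space_uminus[OF V yV]] bspec[OF bspec[OF p'(3) function_space_uminus[OF V yV]] y] by simp
    then show "s \<le> q y" using minus[OF yV] sublinear_on_zero[OF V p] by simp
  qed
qed

section \<open>The Daniell-Stone integral\<close>

text \<open>A vector lattice with constants and a positive linear functional on it; closure under
  absolute values yields maxima and minima. No sigma-field is given: it is generated by
  \<open>L\<close>.\<close>

locale daniell =
  fixes L :: "('a \<Rightarrow> real) set" and E :: "('a \<Rightarrow> real) \<Rightarrow> real"
  assumes L_space: "function_space L"
    and L_one: "(\<lambda>_. 1) \<in> L"
    and L_abs: "f \<in> L \<Longrightarrow> (\<lambda>\<omega>. \<bar>f \<omega>\<bar>) \<in> L"
    and E_linear: "linear_on_functions L E"
    and E_nonneg: "f \<in> L \<Longrightarrow> (\<And>\<omega>. 0 \<le> f \<omega>) \<Longrightarrow> 0 \<le> E f"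
    and E_continuous: "(\<And>n::nat. F n \<in> L) \<Longrightarrow> (\<And>\<omega>. decseq (\<lambda>n. F n \<omega>)) \<Longrightarrow>
      (\<And>\<omega>. (\<lambda>n. F n \<omega>) \<longlonglongrightarrow> 0) \<Longrightarrow> (\<lambda>n. E (F n)) \<longlonglongrightarrow> 0"
begin

lemmas L_add = function_space_add[OF L_space]
lemmas L_scale = function_space_scale[OF L_space]
lemmas L_diff = function_space_diff[OF L_space]

lemma L_const: "(\<lambda>_. c) \<in> L"
  using L_scale[OF L_one, of c] by simp

lemma L_max: assumes "f \<in> L" "g \<in> L" shows "(\<lambda>\<omega>. max (f \<omega>) (g \<omega>)) \<in> L"
proof -
  have "(\<lambda>\<omega>. max (f \<omega>) (g \<omega>)) = (\<lambda>\<omega>. (1/2) * ((f \<omega> + g \<omega>) + \<bar>f \<omega> - g \<omega>\<bar>))"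
    by (auto simp: fun_eq_iff max_def)
  then show ?thesis using L_scale[OF L_add[OF L_add[OF assms] L_abs[OF L_diff[OF assms]]], of "1/2"] by simp
qed

lemma L_min: assumes "f \<in> L" "g \<in> L" shows "(\<lambda>\<omega>. min (f \<omega>) (g \<omega>)) \<in> L"
proof -
  have "min (f \<omega>) (g \<omega>) = (f \<omega> + g \<omega>) - max (f \<omega>) (g \<omega>)" for \<omega> by (simp add: max_def min_def)
  then show ?thesis using L_diff[OF L_add[OF assms] L_max[OF assms]] by simp
qed

lemma L_sum: "(\<And>i. i \<in> I \<Longrightarrow> f i \<in> L) \<Longrightarrow> (\<lambda>\<omega>. \<Sum>i\<in>I. f i \<omega>) \<in> L"
proof (induction I rule: infinite_finite_induct)
  case (insert i I)
  then show ?case using L_add[of "f i" "\<lambda>\<omega>. \<Sum>i\<in>I. f i \<omega>"] by simp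
qed (use function_space_zero[OF L_space] in auto)

lemma E_add: "f \<in> L \<Longrightarrow> g \<in> L \<Longrightarrow> E (\<lambda>\<omega>. f \<omega> + g \<omega>) = E f + E g"
  using E_linear by (auto simp: linear_on_functions_def)

lemma E_scale: "f \<in> L \<Longrightarrow> E (\<lambda>\<omega>. t * f \<omega>) = t * E f"
  using E_linear by (auto simp: linear_on_functions_def)

lemma E_diff: "f \<in> L \<Longrightarrow> g \<in> L \<Longrightarrow> E (\<lambda>\<omega>. f \<omega> - g \<omega>) = E f - E g"
  using E_add[of f "\<lambda>\<omega>. -1 * g \<omega>"] E_scale[of g "-1"] L_scale[of g "-1"] by simp

lemma E_zero: "E (\<lambda>_. 0) = 0"
  using E_scale[OF L_one, of 0] by simp

lemma E_sum: "(\<And>i. i \<in> I \<Longrightarrow> f i \<in> L) \<Longrightarrow> E (\<lambda>\<omega>. \<Sum>i\<in>I. f i \<omega>) = (\<Sum>i\<in>I. E (f i))"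
proof (induction I rule: infinite_finite_induct)
  case (insert i I)
  then show ?case using E_add[of "f i" "\<lambda>\<omega>. \<Sum>i\<in>I. f i \<omega>"] L_sum[of I f] by simp
qed (use E_zero in auto)

lemma E_mono: "f \<in> L \<Longrightarrow> g \<in> L \<Longrightarrow> (\<And>\<omega>. f \<omega> \<le> g \<omega>) \<Longrightarrow> E f \<le> E g"
  using E_nonneg[OF L_diff[of g f]] E_diff[of g f] by simp

section \<open>The Daniell outer measure\<close>

definition incr :: "(nat \<Rightarrow> 'a \<Rightarrow> real) \<Rightarrow> bool" where
  "incr g \<longleftrightarrow> (\<forall>n. g n \<in> L) \<and> (\<forall>n \<omega>. 0 \<le> g n \<omega>) \<and> (\<forall>m n \<omega>. m \<le> n \<longrightarrow> g m \<omega> \<le> g n \<omega>)"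

text \<open>Quantifying over \<open>c < 1\<close> says that the supremum of \<open>g\<close> is at
  least 1 on \<open>A\<close>, without forming that supremum, which may be infinite.\<close>

definition covers :: "(nat \<Rightarrow> 'a \<Rightarrow> real) \<Rightarrow> 'a set \<Rightarrow> bool" where
  "covers g A \<longleftrightarrow> incr g \<and> (\<forall>\<omega>\<in>A. \<forall>c<1. \<exists>n. c < g n \<omega>)"

definition limE :: "(nat \<Rightarrow> 'a \<Rightarrow> real) \<Rightarrow> ennreal" where
  "limE g = (SUP n. ennreal (E (g n)))"

text \<open>Upper integral of the indicator of \<open>A\<close>: the infimum of the integrals of
  increasing limits from \<open>L\<close> that dominate it.\<close>

definition outer :: "'a set \<Rightarrow> ennreal" where
  "outer A = (INF g\<in>{g. covers g A}. limE g)"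

lemma incrD: assumes "incr g"
  shows "g n \<in> L" "0 \<le> g n \<omega>" "m \<le> n \<Longrightarrow> g m \<omega> \<le> g n \<omega>" "0 \<le> E (g n)" "m \<le> n \<Longrightarrow> E (g m) \<le> E (g n)"
  using assms by (auto simp: incr_def intro: E_nonneg E_mono)

lemma outer_le: "covers g A \<Longrightarrow> outer A \<le> limE g"
  unfolding outer_def by (rule INF_lower) simp

lemma covers_mono: "covers g B \<Longrightarrow> A \<subseteq> B \<Longrightarrow> covers g A"
  by (auto simp: covers_def)

lemma covers_const: "covers (\<lambda>_ _. 1) A"
  using L_one by (auto simp: covers_def incr_def)

lemma outer_le_E_one: "outer A \<le> ennreal (E (\<lambda>_. 1))"
  using outer_le[OF covers_const] by (simp add: limE_def)

lemma outer_mono: "A \<subseteq> B \<Longrightarrow> outer A \<le> outer B"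
  unfolding outer_def by (rule INF_superset_mono) (auto intro: covers_mono)

lemma outer_empty: "outer {} = 0"
proof -
  have "covers (\<lambda>_ _. 0) {}" using L_const[of 0] by (auto simp: covers_def incr_def)
  from outer_le[OF this] show ?thesis by (simp add: limE_def E_zero)
qed

lemma outer_approx:
  assumes "0 < (e::real)" obtains g where "covers g A" "limE g \<le> outer A + ennreal e"
proof -
  have "outer A < outer A + ennreal e"
    using outer_le_E_one[of A] assms ennreal_add_left_cancel_less[of "outer A" 0 "ennreal e"]
    by (auto simp: top_unique)
  then show thesis using that unfolding outer_def INF_less_iff by (auto intro: less_imp_le)
qed

text \<open>Near-optimal covers \<open>g i\<close> with errors \<open>e / 2 ^ (i + 1)\<close> are
  merged diagonally: \<open>G n\<close> adds the \<open>n\<close>-th terms of the first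
  \<open>n + 1\<close> covers. It is a finite sum, hence in \<open>L\<close>, and increasing, and it
  eventually dominates each single term of each cover.\<close>

lemma outer_countably_subadditive:
  fixes A :: "nat \<Rightarrow> 'a set"
  shows "outer (\<Union>i. A i) \<le> (\<Sum>i. outer (A i))"
proof (rule ennreal_le_epsilon)
  fix e :: real assume e: "0 < e"
  have "\<exists>g. covers g (A i) \<and> limE g \<le> outer (A i) + ennreal (e * (1/2) ^ Suc i)" for i
    using outer_approx[of "e * (1/2) ^ Suc i" "A i"] e by auto
  then obtain g where g: "\<And>i. covers (g i) (A i)"
      "\<And>i. limE (g i) \<le> outer (A i) + ennreal (e * (1/2) ^ Suc i)" by metis
  have gi: "incr (g i)" for i using g(1) by (auto simp: covers_def)
  define G where "G n \<omega> = (\<Sum>i\<le>n. g i n \<omega>)" for n \<omega>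
  have g_le_G: "g i n \<omega> \<le> G n \<omega>" if "i \<le> n" for i n \<omega>
    unfolding G_def using that incrD(2)[OF gi] by (intro member_le_sum) auto
  have "incr G"
    unfolding incr_def
  proof (intro conjI allI impI)
    show "G n \<in> L" for n unfolding G_def by (intro L_sum incrD(1)[OF gi])
    show "0 \<le> G n \<omega>" for n \<omega> unfolding G_def by (intro sum_nonneg incrD(2)[OF gi])
    show "G m \<omega> \<le> G n \<omega>" if "m \<le> n" for m n \<omega>
    proof -
      have "G m \<omega> \<le> (\<Sum>i\<le>m. g i n \<omega>)" unfolding G_def by (intro sum_mono incrD(3)[OF gi that])
      also have "\<dots> \<le> G n \<omega>" unfolding G_def
        using that by (intro sum_mono2 incrD(2)[OF gi]) auto
      finally show ?thesis .
    qed
  qed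
  moreover have "\<exists>n. c < G n \<omega>" if "\<omega> \<in> A i" "c < 1" for \<omega> i c
  proof -
    obtain n where n: "c < g i n \<omega>" using g(1)[of i] \<open>\<omega> \<in> A i\<close> \<open>c < 1\<close> unfolding covers_def by blast
    also have "\<dots> \<le> g i (max i n) \<omega>" by (rule incrD(3)[OF gi]) simp
    also have "\<dots> \<le> G (max i n) \<omega>" by (rule g_le_G) simp
    finally show ?thesis by blast
  qed
  ultimately have "covers G (\<Union>i. A i)" by (auto simp: covers_def)
  then have "outer (\<Union>i. A i) \<le> limE G" by (rule outer_le)
  also have "limE G \<le> (\<Sum>i. limE (g i))"
    unfolding limE_def[of G]
  proof (rule SUP_least)
    fix n
    have "ennreal (E (G n)) = (\<Sum>i\<le>n. ennreal (E (g i n)))"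
      unfolding G_def using incrD(1,4)[OF gi] by (subst E_sum) (auto simp: sum_ennreal)
    also have "\<dots> \<le> (\<Sum>i\<le>n. limE (g i))"
      unfolding limE_def by (intro sum_mono SUP_upper) simp
    also have "\<dots> \<le> (\<Sum>i. limE (g i))"
      by (intro sum_le_suminf) auto
    finally show "ennreal (E (G n)) \<le> (\<Sum>i. limE (g i))" .
  qed
  also have "\<dots> \<le> (\<Sum>i. outer (A i) + ennreal (e * (1/2) ^ Suc i))"
    using g(2) by (intro suminf_le) auto
  also have "\<dots> = (\<Sum>i. outer (A i)) + (\<Sum>i. ennreal (e * (1/2) ^ Suc i))"
    by (intro suminf_add[symmetric]) auto
  also have "(\<Sum>i. ennreal (e * (1/2) ^ Suc i)) = ennreal e"
    using e sums_mult[OF power_half_series, of e]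
    by (intro suminf_ennreal_eq) auto
  finally show "outer (\<Union>i. A i) \<le> (\<Sum>i. outer (A i)) + ennreal e" .
qed

lemma outer_measure_space: "outer_measure_space (Pow UNIV) outer"
  unfolding outer_measure_space_def positive_def increasing_def countably_subadditive_def
  using outer_empty outer_mono outer_countably_subadditive by auto

text \<open>Functions of \<open>L\<close> that increase with \<open>n\<close> to the indicator of
  \<open>{t < f}\<close>.\<close>

definition bump :: "('a \<Rightarrow> real) \<Rightarrow> real \<Rightarrow> nat \<Rightarrow> 'a \<Rightarrow> real" where
  "bump f t n \<omega> = min 1 (real n * max (f \<omega> - t) 0)"

lemma bump_L: "f \<in> L \<Longrightarrow> bump f t n \<in> L"
  unfolding bump_def[abs_def] by (intro L_min L_const L_scale L_max L_diff)

lemma bump_bounds: "0 \<le> bump f t n \<omega>" "bump f t n \<omega> \<le> 1" "f \<omega> \<le> t \<Longrightarrow> bump f t n \<omega> = 0"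
  by (auto simp: bump_def)

lemma bump_mono: "m \<le> n \<Longrightarrow> bump f t m \<omega> \<le> bump f t n \<omega>"
  by (auto simp: bump_def intro!: min.coboundedI2 mult_right_mono)

lemma bump_eventually_one: assumes "t < f \<omega>" shows "\<exists>n0. \<forall>n\<ge>n0. bump f t n \<omega> = 1"
proof -
  obtain n0 :: nat where "1 / (f \<omega> - t) < real n0" using reals_Archimedean2 by blast
  then have n0: "1 \<le> real n0 * (f \<omega> - t)" using assms by (simp add: field_simps)
  have "bump f t n \<omega> = 1" if "n0 \<le> n" for n
  proof -
    have "real n0 * (f \<omega> - t) \<le> real n * (f \<omega> - t)" using that assms by (intro mult_right_mono) auto
    then have "1 \<le> real n * (f \<omega> - t)" using n0 by linarith
    then show ?thesis using assms by (simp add: bump_def min_absorb1)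
  qed
  then show ?thesis by blast
qed

text \<open>For a cover \<open>g\<close> of \<open>A\<close> the functions
  \<open>(h - g n)\<^sup>+\<close> decrease to 0 everywhere, so Daniell continuity makes
  \<open>E h \<le> E (g n) + E ((h - g n)\<^sup>+)\<close> sharp in the limit. This keeps the outer
  measure from collapsing.\<close>

lemma le_outer:
  assumes h: "h \<in> L" "\<And>\<omega>. 0 \<le> h \<omega>" "\<And>\<omega>. h \<omega> \<le> 1" "\<And>\<omega>. \<omega> \<notin> A \<Longrightarrow> h \<omega> = 0"
  shows "ennreal (E h) \<le> outer A"
  unfolding outer_def
proof (rule INF_greatest)
  fix g assume "g \<in> {g. covers g A}"
  then have g: "covers g A" "incr g" by (auto simp: covers_def)
  define d where "d n \<omega> = max (h \<omega> - g n \<omega>) 0" for n \<omega>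
  have dL: "d n \<in> L" for n
    unfolding d_def[abs_def] by (intro L_max L_const L_diff h incrD(1)[OF g(2)])
  have dd: "decseq (\<lambda>n. d n \<omega>)" for \<omega>
    unfolding d_def decseq_def
    by (intro allI impI max.mono diff_left_mono order_refl incrD(3)[OF g(2)])
  have "(\<lambda>n. d n \<omega>) \<longlonglongrightarrow> 0" for \<omega>
  proof (rule LIMSEQ_I)
    fix r :: real assume r: "0 < r"
    have "\<exists>n0. d n0 \<omega> < r"
    proof (cases "\<omega> \<in> A")
      case True
      then obtain n0 where "1 - r < g n0 \<omega>" using g(1) r by (force simp: covers_def)
      then show ?thesis using h(3)[of \<omega>] r by (intro exI[of _ n0]) (auto simp: d_def)
    next
      case False
      then show ?thesis using h(4)[OF False] incrD(2)[OF g(2), of 0 \<omega>] r by (intro exI[of _ 0]) (simp add: d_def)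
    qed
    then obtain n0 where "d n0 \<omega> < r" by blast
    then have "d n \<omega> < r" if "n0 \<le> n" for n using decseqD[OF dd that, of \<omega>] by linarith
    moreover have "0 \<le> d n \<omega>" for n by (simp add: d_def)
    ultimately show "\<exists>no. \<forall>n\<ge>no. norm (d n \<omega> - 0) < r" by auto
  qed
  then have lim: "(\<lambda>n. E (d n)) \<longlonglongrightarrow> 0" using dL dd by (intro E_continuous) auto
  show "ennreal (E h) \<le> limE g"
  proof (rule ennreal_le_epsilon)
    fix e :: real assume e: "0 < e"
    obtain n where n: "E (d n) < e"
      using order_tendstoD(2)[OF lim e] unfolding eventually_sequentially by blast
    have "E h \<le> E (\<lambda>\<omega>. g n \<omega> + d n \<omega>)"
      by (intro E_mono L_add dL h(1) incrD(1)[OF g(2)]) (auto simp: d_def)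
    also have "\<dots> = E (g n) + E (d n)" by (intro E_add dL incrD(1)[OF g(2)])
    finally have "E h \<le> E (g n) + e" using n by simp
    then have "ennreal (E h) \<le> ennreal (E (g n) + e)" by (rule ennreal_leI)
    also have "\<dots> = ennreal (E (g n)) + ennreal e" using incrD(4)[OF g(2)] e by simp
    also have "\<dots> \<le> limE g + ennreal e" unfolding limE_def by (intro add_right_mono SUP_upper) simp
    finally show "ennreal (E h) \<le> limE g + ennreal e" .
  qed
qed

text \<open>A cover \<open>g\<close> of \<open>B\<close> splits as \<open>min g h + (g - h)\<^sup>+\<close>, where \<open>h\<close> increases to the
  indicator of \<open>A\<close>: the first part covers \<open>B \<inter> A\<close>, the second one covers \<open>B - A\<close>.\<close>

lemma superlevel_in_lambda_system:
  assumes f: "f \<in> L" shows "{\<omega>. t < f \<omega>} \<in> lambda_system UNIV (Pow UNIV) outer"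
proof -
  let ?A = "{\<omega>. t < f \<omega>}" and ?h = "bump f t"
  have split: "outer (?A \<inter> B) + outer (B - ?A) \<le> outer B" for B
    unfolding outer_def[of B]
  proof (rule INF_greatest)
    fix g assume "g \<in> {g. covers g B}"
    then have g: "covers g B" "incr g" by (auto simp: covers_def)
    let ?u = "\<lambda>n \<omega>. min (g n \<omega>) (?h n \<omega>)"
    have uL: "(\<lambda>\<omega>. min (g n \<omega>) (?h m \<omega>)) \<in> L" for n m by (intro L_min bump_L f incrD(1)[OF g(2)])
    have "covers ?u (?A \<inter> B)"
      unfolding covers_def
    proof (intro conjI ballI allI impI)
      show "incr ?u"
        unfolding incr_def using uL incrD(2,3)[OF g(2)] bump_bounds(1) bump_mono
        by (simp add: min.coboundedI1 min.coboundedI2)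
      fix \<omega> and c :: real assume w: "\<omega> \<in> ?A \<inter> B" and c: "c < 1"
      obtain n where n: "c < g n \<omega>" using g(1) w c unfolding covers_def by blast
      obtain n0 where n0: "\<forall>n\<ge>n0. ?h n \<omega> = 1" using bump_eventually_one w by blast
      have "g n \<omega> \<le> g (max n n0) \<omega>" by (rule incrD(3)[OF g(2)]) simp
      then have "c < ?u (max n n0) \<omega>" using n n0 c by simp
      then show "\<exists>n. c < ?u n \<omega>" ..
    qed
    then have 1: "outer (?A \<inter> B) \<le> limE ?u" by (rule outer_le)
    \<comment> \<open>The index \<open>m\<close> of the bump stays fixed while the cover runs
      through \<open>n\<close>: subtracting a moving bump would destroy monotonicity of
      \<open>?v\<close>. The supremum over \<open>m\<close> is taken afterwards.\<close>
    have 2: "ennreal (E (?u m)) + outer (B - ?A) \<le> limE g" for m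
    proof -
      let ?v = "\<lambda>n \<omega>. max (g n \<omega> - ?h m \<omega>) 0"
      have vL: "?v n \<in> L" for n by (intro L_max L_diff L_const bump_L f incrD(1)[OF g(2)])
      have "covers ?v (B - ?A)"
        unfolding covers_def
      proof (intro conjI ballI allI impI)
        show "incr ?v"
          unfolding incr_def using vL incrD(3)[OF g(2)] by (simp add: max.coboundedI1)
        fix \<omega> and c :: real assume w: "\<omega> \<in> B - ?A" and c: "c < 1"
        obtain n where n: "c < g n \<omega>" using g(1) w c unfolding covers_def by blast
        then show "\<exists>n. c < ?v n \<omega>" using w bump_bounds(3)[of f \<omega> t m] by (intro exI[of _ n]) auto
      qed
      then have "outer (B - ?A) \<le> limE ?v" by (rule outer_le)
      then have "ennreal (E (?u m)) + outer (B - ?A) \<le> ennreal (E (?u m)) + limE ?v"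
        by (rule add_left_mono)
      also have "\<dots> = (SUP n. ennreal (E (?u m)) + ennreal (E (?v n)))"
        unfolding limE_def by (intro ennreal_SUP_add_right) simp
      also have "\<dots> \<le> limE g"
      proof (rule SUP_least)
        fix n
        let ?N = "max m n"
        have "E (?u m) + E (?v n) \<le> E (\<lambda>\<omega>. min (g ?N \<omega>) (?h m \<omega>)) + E (?v ?N)"
          using incrD(3)[OF g(2)] by (intro add_mono E_mono uL vL) (simp_all add: min.coboundedI1 max.coboundedI1)
        also have "\<dots> = E (\<lambda>\<omega>. min (g ?N \<omega>) (?h m \<omega>) + ?v ?N \<omega>)"
          by (intro E_add[symmetric] uL vL)
        also have "(\<lambda>\<omega>. min (g ?N \<omega>) (?h m \<omega>) + ?v ?N \<omega>) = g ?N" by (auto simp: min_def max_def)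
        finally have "ennreal (E (?u m) + E (?v n)) \<le> ennreal (E (g ?N))" by (rule ennreal_leI)
        also have "\<dots> \<le> limE g" unfolding limE_def by (rule SUP_upper) simp
        finally show "ennreal (E (?u m)) + ennreal (E (?v n)) \<le> limE g"
          using E_nonneg[OF uL, of m m] E_nonneg[OF vL, of n] incrD(2)[OF g(2)] bump_bounds(1)
          by (simp add: ennreal_plus)
      qed
      finally show ?thesis .
    qed
    have "outer (?A \<inter> B) + outer (B - ?A) \<le> limE ?u + outer (B - ?A)" using 1 by (rule add_right_mono)
    also have "\<dots> = (SUP m. ennreal (E (?u m)) + outer (B - ?A))"
      unfolding limE_def by (intro ennreal_SUP_add_left[symmetric]) simp
    also have "\<dots> \<le> limE g" by (intro SUP_least 2)
    finally show "outer (?A \<inter> B) + outer (B - ?A) \<le> limE g" .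
  qed
  have "outer B \<le> outer (?A \<inter> B) + outer (B - ?A)" for B
  proof -
    \<comment> \<open>Padding with empty sets turns countable subadditivity into the binary
      case.\<close>
    let ?S = "\<lambda>i::nat. if i = 0 then ?A \<inter> B else if i = 1 then B - ?A else {}"
    have "outer B \<le> outer (\<Union>i. ?S i)" by (rule outer_mono) (auto split: if_splits)
    also have "\<dots> \<le> (\<Sum>i. outer (?S i))" by (rule outer_countably_subadditive)
    also have "\<dots> = (\<Sum>i\<in>{0,1}. outer (?S i))" by (rule suminf_finite) (auto simp: outer_empty)
    finally show ?thesis by simp
  qed
  then show ?thesis
    unfolding lambda_system_def using split
    by (auto intro!: antisym simp: Diff_Int_distrib2 Compl_eq_Diff_UNIV[symmetric] Diff_eq Int_commute)
qed

section \<open>The measure on the sigma-field generated by \<open>L\<close>, and its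
  integral\<close>

definition \<S> :: "'a set set" where "\<S> = sigma_sets UNIV {{\<omega>. t < f \<omega>} |f t. f \<in> L}"

definition \<mu> :: "'a measure" where "\<mu> = measure_of UNIV \<S> outer"

lemma sigma_algebra_S: "sigma_algebra UNIV \<S>"
  unfolding \<S>_def by (rule sigma_algebra_sigma_sets) simp

text \<open>Caratheodory makes \<open>outer\<close> a measure on its lambda system, which contains
  the generating superlevel sets and hence all of \<S>.\<close>

lemma space_mu: "space \<mu> = UNIV" and sets_mu: "sets \<mu> = \<S>"
  and emeasure_mu: "A \<in> \<S> \<Longrightarrow> emeasure \<mu> A = outer A"
proof -
  have lam: "measure_space UNIV (lambda_system UNIV (Pow UNIV) outer) outer"
    by (rule sigma_algebra.caratheodory_lemma[OF sigma_algebra_Pow outer_measure_space])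
  then have sa: "sigma_algebra UNIV (lambda_system UNIV (Pow UNIV) outer)"
    by (simp add: measure_space_def)
  have "\<S> \<subseteq> lambda_system UNIV (Pow UNIV) outer"
    unfolding \<S>_def by (rule sigma_algebra.sigma_sets_subset[OF sa])
      (use superlevel_in_lambda_system in blast)
  then have ms: "measure_space UNIV \<S> outer" by (rule measure_down[OF lam sigma_algebra_S])
  show "space \<mu> = UNIV" by (simp add: \<mu>_def space_measure_of_conv)
  show s: "sets \<mu> = \<S>"
    unfolding \<mu>_def using sigma_algebra.sets_measure_of_eq[OF sigma_algebra_S] by simp
  show "emeasure \<mu> A = outer A" if "A \<in> \<S>"
    unfolding \<mu>_def using that ms
    by (intro emeasure_measure_of_sigma) (auto simp: measure_space_def)
qed

lemma L_measurable: assumes "f \<in> L" shows "f \<in> borel_measurable \<mu>"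
  unfolding borel_measurable_iff_greater
  using assms by (auto simp: space_mu sets_mu \<S>_def)

lemma emeasure_mu_superlevel: "f \<in> L \<Longrightarrow> emeasure \<mu> {\<omega>. t < f \<omega>} = outer {\<omega>. t < f \<omega>}"
  by (rule emeasure_mu) (auto simp: \<S>_def)

lemma finite_measure_mu: "finite_measure \<mu>"
proof
  have "emeasure \<mu> (space \<mu>) \<le> ennreal (E (\<lambda>_. 1))"
    using outer_le_E_one[of "{\<omega>. 0 < (1::real)}"] emeasure_mu_superlevel[OF L_one, of 0]
    by (simp add: space_mu)
  then show "emeasure \<mu> (space \<mu>) \<noteq> \<infinity>" by (auto simp: top_unique)
qed

lemma measure_mu_UNIV: "measure \<mu> UNIV = E (\<lambda>_. 1)"
proof -
  have "outer UNIV = ennreal (E (\<lambda>_. 1))"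
    using outer_le_E_one le_outer[OF L_one, of UNIV] by (auto intro: antisym)
  moreover have "emeasure \<mu> UNIV = outer UNIV"
    using emeasure_mu_superlevel[OF L_one, of 0] by simp
  ultimately show ?thesis using E_nonneg[OF L_one] by (simp add: measure_def)
qed

lemma integrable_mu_bounded:
  assumes "f \<in> L" "\<And>\<omega>. \<bar>f \<omega>\<bar> \<le> c" shows "integrable \<mu> f"
  using assms by (intro finite_measure.integrable_const_bound[OF finite_measure_mu, of _ c] L_measurable) auto

text \<open>Layer-cake comparison at the levels \<open>j / m\<close>.\<close>

lemma E_le_integral:
  assumes f: "f \<in> L" "\<And>\<omega>. 0 \<le> f \<omega>" "\<And>\<omega>. f \<omega> \<le> 1"
  shows "E f \<le> integral\<^sup>L \<mu> f"
proof -
  interpret finite_measure \<mu> by (rule finite_measure_mu)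
  have fint: "integrable \<mu> f" using f by (intro integrable_mu_bounded[of f 1]) (auto simp: abs_of_nonneg)
  have bound: "E f - integral\<^sup>L \<mu> f \<le> E (\<lambda>_. 1) / real m" if m: "0 < m" for m :: nat
  proof -
    define A where "A j = {\<omega>. real j / real m < f \<omega>}" for j
    \<comment> \<open>The slice of \<open>f\<close> between heights \<open>j/m\<close> and
      \<open>(j+1)/m\<close>, rescaled to height 1. It lies between the indicators of
      \<open>A (Suc j)\<close> and \<open>A j\<close>, and since \<open>0 \<le> f \<le> 1\<close>
      the slices add up to \<open>m f\<close>.\<close>
    define \<phi> where "\<phi> j \<omega> = real m * (min (f \<omega>) (real (Suc j) / real m) - min (f \<omega>) (real j / real m))" for j \<omega>
    have A: "A j \<in> sets \<mu>" for j unfolding A_def sets_mu \<S>_def using f(1) by blast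
    have \<phi>L: "\<phi> j \<in> L" for j unfolding \<phi>_def[abs_def] by (intro L_scale L_diff L_min L_const f)
    have step: "real (Suc j) / real m = real j / real m + 1 / real m" for j
      by (simp add: add_divide_distrib)
    have \<phi>0: "0 \<le> \<phi> j \<omega>" for j \<omega>
    proof -
      have "0 \<le> 1 / real m" by simp
      then have "0 \<le> min (f \<omega>) (real (Suc j) / real m) - min (f \<omega>) (real j / real m)"
        unfolding step by linarith
      then show ?thesis unfolding \<phi>_def by (intro mult_nonneg_nonneg) auto
    qed
    have \<phi>1: "\<phi> j \<omega> \<le> 1" for j \<omega>
    proof -
      have d: "0 \<le> 1 / real m" by simp
      have "min (f \<omega>) (real (Suc j) / real m) - min (f \<omega>) (real j / real m) \<le> 1 / real m"
        unfolding step using d by linarith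
      then show ?thesis unfolding \<phi>_def using m by (simp add: field_simps)
    qed
    have \<phi>_out: "\<phi> j \<omega> = 0" if "\<omega> \<notin> A j" for j \<omega>
    proof -
      have "f \<omega> \<le> real j / real m" "0 \<le> 1 / real m" using that by (auto simp: A_def)
      then have "min (f \<omega>) (real (Suc j) / real m) = f \<omega>" "min (f \<omega>) (real j / real m) = f \<omega>"
        unfolding step by linarith+
      then show ?thesis unfolding \<phi>_def by simp
    qed
    have \<phi>_in: "\<phi> j \<omega> = 1" if "\<omega> \<in> A (Suc j)" for j \<omega>
    proof -
      have "real j / real m + 1 / real m < f \<omega>" "0 < 1 / real m" using that m unfolding A_def step by auto
      then have "min (f \<omega>) (real (Suc j) / real m) - min (f \<omega>) (real j / real m) = 1 / real m"
        unfolding step by linarith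
      then show ?thesis unfolding \<phi>_def using m by simp
    qed
    have sum_\<phi>: "(\<Sum>j<m. \<phi> j \<omega>) = real m * f \<omega>" for \<omega>
    proof -
      have "(\<Sum>j<m. \<phi> j \<omega>) = real m * (min (f \<omega>) (real m / real m) - min (f \<omega>) (real 0 / real m))"
        unfolding \<phi>_def sum_distrib_left[symmetric]
        using sum_lessThan_telescope[of "\<lambda>j. min (f \<omega>) (real j / real m)" m] by simp
      then show ?thesis using f(2,3)[of \<omega>] m by (simp add: min_def)
    qed
    have "real m * E f = E (\<lambda>\<omega>. \<Sum>j<m. \<phi> j \<omega>)" unfolding sum_\<phi> by (rule E_scale[symmetric, OF f(1)])
    also have "\<dots> = (\<Sum>j<m. E (\<phi> j))" by (rule E_sum) (rule \<phi>L)
    also have "\<dots> \<le> (\<Sum>j<m. measure \<mu> (A j))"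
    proof (rule sum_mono)
      fix j
      have "ennreal (E (\<phi> j)) \<le> outer (A j)" by (rule le_outer[OF \<phi>L \<phi>0 \<phi>1 \<phi>_out])
      also have "\<dots> = ennreal (measure \<mu> (A j))"
        using emeasure_mu_superlevel[OF f(1)] unfolding A_def by (simp add: emeasure_eq_measure)
      finally show "E (\<phi> j) \<le> measure \<mu> (A j)" by (simp add: ennreal_le_iff)
    qed
    also have "\<dots> = integral\<^sup>L \<mu> (\<lambda>\<omega>. \<Sum>j<m. indicator (A j) \<omega>)"
      using A by (subst Bochner_Integration.integral_sum) (auto simp: space_mu emeasure_eq_measure)
    also have "\<dots> \<le> integral\<^sup>L \<mu> (\<lambda>\<omega>. 1 + real m * f \<omega>)"
    proof (rule integral_mono)
      show "integrable \<mu> (\<lambda>\<omega>. \<Sum>j<m. indicator (A j) \<omega> :: real)"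
        using A by (intro Bochner_Integration.integrable_sum) (auto simp: space_mu emeasure_eq_measure)
      show "integrable \<mu> (\<lambda>\<omega>. 1 + real m * f \<omega>)" using fint by auto
      fix \<omega>
      \<comment> \<open>Shifting the index by one trades \<open>A j\<close> for
        \<open>A (Suc j)\<close> and costs at most the single term \<open>A 0\<close>. This is the
        error \<open>E 1\<close>, which becomes \<open>E 1 / m\<close> after division.\<close>
      have "(\<Sum>j<m. indicator (A j) \<omega> :: real) \<le> (\<Sum>j<Suc m. indicator (A j) \<omega>)" by simp
      also have "\<dots> = indicator (A 0) \<omega> + (\<Sum>j<m. indicator (A (Suc j)) \<omega>)"
        by (rule sum.lessThan_Suc_shift)
      also have "\<dots> \<le> 1 + (\<Sum>j<m. \<phi> j \<omega>)"
        using \<phi>0 \<phi>_in by (intro add_mono sum_mono) (auto simp: indicator_def)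
      finally show "(\<Sum>j<m. indicator (A j) \<omega>) \<le> 1 + real m * f \<omega>" unfolding sum_\<phi> .
    qed
    also have "\<dots> = E (\<lambda>_. 1) + real m * integral\<^sup>L \<mu> f"
      using fint by (simp add: measure_mu_UNIV space_mu)
    finally show ?thesis using m by (simp add: field_simps)
  qed
  have "(\<lambda>m. E (\<lambda>_. 1) / real m) \<longlonglongrightarrow> 0" by (rule lim_const_over_n)
  then have "E f - integral\<^sup>L \<mu> f \<le> 0"
    by (rule LIMSEQ_le_const) (use bound in \<open>auto intro!: exI[of _ 1]\<close>)
  then show ?thesis by simp
qed

text \<open>The reverse inequality is \<open>E_le_integral\<close> applied to
  \<open>1 - f\<close>.\<close>

lemma integral_mu_unit:
  assumes f: "f \<in> L" "\<And>\<omega>. 0 \<le> f \<omega>" "\<And>\<omega>. f \<omega> \<le> 1"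
  shows "integral\<^sup>L \<mu> f = E f"
proof -
  interpret finite_measure \<mu> by (rule finite_measure_mu)
  have fint: "integrable \<mu> f" using f by (intro integrable_mu_bounded[of f 1]) (auto simp: abs_of_nonneg)
  have "E (\<lambda>\<omega>. 1 - f \<omega>) \<le> integral\<^sup>L \<mu> (\<lambda>\<omega>. 1 - f \<omega>)"
    using f by (intro E_le_integral L_diff L_one) auto
  then have "integral\<^sup>L \<mu> f \<le> E f"
    using fint by (simp add: E_diff[OF L_one f(1)] measure_mu_UNIV space_mu)
  then show ?thesis using E_le_integral[OF f] by simp
qed

text \<open>Truncations reduce this to the unit case after rescaling; the level \<open>Suc n\<close>
  keeps the divisor positive. The remainders \<open>f - g n\<close> decrease to 0, so Daniell
  continuity and monotone convergence reach the same limit and give integrability as well.\<close>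

lemma integral_mu_nonneg:
  assumes f: "f \<in> L" "\<And>\<omega>. 0 \<le> f \<omega>"
  shows "integrable \<mu> f \<and> integral\<^sup>L \<mu> f = E f"
proof -
  define g where "g n \<omega> = min (f \<omega>) (real (Suc n))" for n \<omega>
  have gL: "g n \<in> L" for n unfolding g_def[abs_def] by (intro L_min L_const f)
  have g_bounds: "0 \<le> g n \<omega>" "g n \<omega> \<le> real (Suc n)" for n \<omega>
    using f(2)[of \<omega>] by (auto simp: g_def)
  have gint: "integrable \<mu> (g n)" for n
    using g_bounds by (intro integrable_mu_bounded[OF gL, of n "real (Suc n)"]) (simp add: abs_of_nonneg)
  have gE: "integral\<^sup>L \<mu> (g n) = E (g n)" for n
  proof -
    have "integral\<^sup>L \<mu> (\<lambda>\<omega>. (1 / real (Suc n)) * g n \<omega>) = E (\<lambda>\<omega>. (1 / real (Suc n)) * g n \<omega>)"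
      using g_bounds by (intro integral_mu_unit L_scale gL) (auto simp: field_simps)
    then show ?thesis unfolding E_scale[OF gL] by simp
  qed
  have g_eq: "eventually (\<lambda>n. g n \<omega> = f \<omega>) sequentially" for \<omega>
  proof -
    obtain N :: nat where "f \<omega> < real N" using reals_Archimedean2 by blast
    then show ?thesis unfolding g_def by (intro eventually_sequentiallyI[of N]) (auto simp: min_def)
  qed
  have mono: "g m \<omega> \<le> g n \<omega>" if "m \<le> n" for m n \<omega> using that by (auto simp: g_def)
  have "(\<lambda>n. E (\<lambda>\<omega>. f \<omega> - g n \<omega>)) \<longlonglongrightarrow> 0"
  proof (rule E_continuous)
    show "(\<lambda>\<omega>. f \<omega> - g n \<omega>) \<in> L" for n by (intro L_diff f gL)
    show "decseq (\<lambda>n. f \<omega> - g n \<omega>)" for \<omega> using mono by (auto simp: decseq_def)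
    show "(\<lambda>n. f \<omega> - g n \<omega>) \<longlonglongrightarrow> 0" for \<omega>
      by (rule tendsto_eventually) (use g_eq[of \<omega>] in \<open>auto elim: eventually_mono\<close>)
  qed
  then have "(\<lambda>n. E f - E (g n)) \<longlonglongrightarrow> 0" by (simp add: E_diff f gL)
  then have lim: "(\<lambda>n. integral\<^sup>L \<mu> (g n)) \<longlonglongrightarrow> E f"
    unfolding gE using tendsto_diff[OF tendsto_const[of "E f"]] by fastforce
  have AE_mono: "AE \<omega> in \<mu>. mono (\<lambda>n. g n \<omega>)" using mono by (auto simp: mono_def)
  have AE_lim: "AE \<omega> in \<mu>. (\<lambda>n. g n \<omega>) \<longlonglongrightarrow> f \<omega>" using g_eq by (auto intro: tendsto_eventually)
  show ?thesis
    using integrable_monotone_convergence[OF gint AE_mono AE_lim lim L_measurable[OF f(1)]]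
      integral_monotone_convergence[OF gint AE_mono AE_lim lim L_measurable[OF f(1)]] by simp
qed

theorem integral_mu:
  assumes f: "f \<in> L" shows "integrable \<mu> f" "integral\<^sup>L \<mu> f = E f"
proof -
  let ?p = "\<lambda>\<omega>. max (f \<omega>) 0" and ?n = "\<lambda>\<omega>. max (- f \<omega>) 0"
  have L: "?p \<in> L" "?n \<in> L"
    using L_max[OF f L_const[of 0]] L_max[OF function_space_uminus[OF L_space f] L_const[of 0]] by auto
  have eq: "f = (\<lambda>\<omega>. ?p \<omega> - ?n \<omega>)" by (auto simp: max_def)
  note p = integral_mu_nonneg[OF L(1)] and n = integral_mu_nonneg[OF L(2)]
  show "integrable \<mu> f" using p n by (subst eq) auto
  show "integral\<^sup>L \<mu> f = E f" using p n by (subst (1 2) eq) (simp add: E_diff L)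
qed

end

section \<open>The space of quasi-continuous functions and the extension of a sublinear expectation\<close>

lemma bounded_borelI:
  "X \<in> borel_measurable borel \<Longrightarrow> (\<And>\<omega>. \<bar>X \<omega>\<bar> \<le> c) \<Longrightarrow> X \<in> bounded_borel"
  by (auto simp: bounded_borel_def bounded_iff)

lemma bounded_borel_measurable [measurable_dest]: "X \<in> bounded_borel \<Longrightarrow> X \<in> borel_measurable borel"
  by (simp add: bounded_borel_def)

lemma bounded_borel_bound:
  assumes "X \<in> bounded_borel" shows "\<exists>k::nat. \<forall>\<omega>. \<bar>X \<omega>\<bar> \<le> real k"
proof -
  obtain c where c: "\<And>\<omega>. \<bar>X \<omega>\<bar> \<le> c" using assms by (auto simp: bounded_borel_def bounded_iff)
  obtain k :: nat where "c \<le> real k" using real_arch_simple by blast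
  then show ?thesis using c order_trans by blast
qed

text \<open>One growth bound from which closure under sums, differences, multiples, absolute values
  and maxima is read off.\<close>

lemma bounded_borel_lipschitz:
  assumes "X \<in> bounded_borel" "Y \<in> bounded_borel" "Z \<in> borel_measurable borel"
    and "\<And>\<omega>. \<bar>Z \<omega>\<bar> \<le> C * (\<bar>X \<omega>\<bar> + \<bar>Y \<omega>\<bar>)" "0 \<le> C"
  shows "Z \<in> bounded_borel"
proof -
  obtain j where j: "\<And>\<omega>. \<bar>X \<omega>\<bar> \<le> real j" using bounded_borel_bound[OF assms(1)] by auto
  obtain k where k: "\<And>\<omega>. \<bar>Y \<omega>\<bar> \<le> real k" using bounded_borel_bound[OF assms(2)] by auto
  have "\<bar>Z \<omega>\<bar> \<le> C * (real j + real k)" for \<omega>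
    using assms(4)[of \<omega>] mult_left_mono[OF add_mono[OF j[of \<omega>] k[of \<omega>]] assms(5)] by linarith
  with assms(3) show ?thesis by (rule bounded_borelI)
qed

lemma bounded_borel_add: "X \<in> bounded_borel \<Longrightarrow> Y \<in> bounded_borel \<Longrightarrow> (\<lambda>\<omega>. X \<omega> + Y \<omega>) \<in> bounded_borel"
  by (rule bounded_borel_lipschitz[of X Y _ 1]) auto

lemma bounded_borel_diff: "X \<in> bounded_borel \<Longrightarrow> Y \<in> bounded_borel \<Longrightarrow> (\<lambda>\<omega>. X \<omega> - Y \<omega>) \<in> bounded_borel"
  by (rule bounded_borel_lipschitz[of X Y _ 1]) auto

lemma bounded_borel_scale: "X \<in> bounded_borel \<Longrightarrow> (\<lambda>\<omega>. c * X \<omega>) \<in> bounded_borel"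
  by (rule bounded_borel_lipschitz[of X X _ "\<bar>c\<bar>"])
    (auto dest: bounded_borel_measurable simp: abs_mult mult_left_mono)

lemma bounded_borel_abs: "X \<in> bounded_borel \<Longrightarrow> (\<lambda>\<omega>. \<bar>X \<omega>\<bar>) \<in> bounded_borel"
  by (rule bounded_borel_lipschitz[of X X _ 1]) (auto dest: bounded_borel_measurable)

lemma bounded_borel_const: "(\<lambda>_. c) \<in> bounded_borel"
  by (rule bounded_borelI[of _ "\<bar>c\<bar>"]) auto

lemma bounded_borel_truncate:
  assumes [measurable]: "X \<in> borel_measurable borel"
  shows "(\<lambda>\<omega>. min \<bar>X \<omega>\<bar> (real k)) \<in> bounded_borel"
  by (rule bounded_borelI[of _ "real k"]) auto

lemma bounded_borel_indicator: "N \<in> sets borel \<Longrightarrow> indicator N \<in> bounded_borel"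
  by (rule bounded_borelI[of _ 1]) (auto simp: indicator_def)

lemma bcontfun_bounded_borel: "f \<in> bcontfun \<Longrightarrow> f \<in> bounded_borel"
  by (auto simp: bcontfun_def bounded_borel_def intro: borel_measurable_continuous_onI)

lemma bcontfunI':
  "continuous_on UNIV f \<Longrightarrow> f \<in> bounded_borel \<Longrightarrow> f \<in> bcontfun"
  by (auto simp: bcontfun_def bounded_borel_def)

lemma bcontfun_continuous: "f \<in> bcontfun \<Longrightarrow> continuous_on UNIV f"
  by (auto simp: bcontfun_def)

locale sublinear_expectation_on =
  fixes \<rho> :: "('a::topological_space \<Rightarrow> real) \<Rightarrow> real"
  assumes sublinear: "sublinear_expectation \<rho>"
begin

lemma mono: "X \<in> bounded_borel \<Longrightarrow> Y \<in> bounded_borel \<Longrightarrow> (\<And>\<omega>. X \<omega> \<le> Y \<omega>) \<Longrightarrow> \<rho> X \<le> \<rho> Y"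
  using sublinear by (simp add: sublinear_expectation_def)

lemma const: "\<rho> (\<lambda>_. c) = c"
  using sublinear by (simp add: sublinear_expectation_def)

lemma subadd: "X \<in> bounded_borel \<Longrightarrow> Y \<in> bounded_borel \<Longrightarrow> \<rho> (\<lambda>\<omega>. X \<omega> + Y \<omega>) \<le> \<rho> X + \<rho> Y"
  using sublinear by (simp add: sublinear_expectation_def)

lemma scale: "X \<in> bounded_borel \<Longrightarrow> 0 \<le> t \<Longrightarrow> \<rho> (\<lambda>\<omega>. t * X \<omega>) = t * \<rho> X"
  using sublinear by (simp add: sublinear_expectation_def)

text \<open>The condition \<open>L1_norm \<rho> X \<le> e\<close> for real \<open>e\<close>, stated
  truncation by truncation so that estimates stay in the reals.\<close>

definition norm_le :: "('a \<Rightarrow> real) \<Rightarrow> real \<Rightarrow> bool" where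
  "norm_le X e \<longleftrightarrow> (\<forall>k::nat. \<rho> (\<lambda>\<omega>. min \<bar>X \<omega>\<bar> (real k)) \<le> e)"

lemma L1_norm_le_iff: "L1_norm \<rho> X \<le> ereal e \<longleftrightarrow> norm_le X e"
  by (simp add: L1_norm_def norm_le_def SUP_le_iff)

lemma L1_norm_nonneg: "0 \<le> L1_norm \<rho> X"
proof -
  have "ereal (\<rho> (\<lambda>\<omega>. min \<bar>X \<omega>\<bar> (real 0))) \<le> L1_norm \<rho> X"
    unfolding L1_norm_def by (rule SUP_upper) simp
  moreover have "(\<lambda>\<omega>. min \<bar>X \<omega>\<bar> (real 0)) = (\<lambda>_. 0)" by (auto simp: min_def)
  ultimately show ?thesis by (simp add: zero_ereal_def const)
qed

lemma Cb_approx_iff: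
  "Cb_approx \<rho> f X \<longleftrightarrow> (\<forall>n. f n \<in> bcontfun) \<and>
     (\<forall>e>0. eventually (\<lambda>n. norm_le (\<lambda>\<omega>. f n \<omega> - X \<omega>) e) sequentially)"
proof -
  let ?a = "\<lambda>n. L1_norm \<rho> (\<lambda>\<omega>. f n \<omega> - X \<omega>)"
  have "?a \<longlonglongrightarrow> 0 \<longleftrightarrow> (\<forall>e>0. eventually (\<lambda>n. norm_le (\<lambda>\<omega>. f n \<omega> - X \<omega>) e) sequentially)"
  proof safe
    fix e :: real assume "?a \<longlonglongrightarrow> 0" "0 < e"
    then have "eventually (\<lambda>n. ?a n < ereal e) sequentially" by (intro order_tendstoD(2)) auto
    then show "eventually (\<lambda>n. norm_le (\<lambda>\<omega>. f n \<omega> - X \<omega>) e) sequentially"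
      by (rule eventually_mono) (simp add: L1_norm_le_iff[symmetric])
  next
    assume ev: "\<forall>e>0. eventually (\<lambda>n. norm_le (\<lambda>\<omega>. f n \<omega> - X \<omega>) e) sequentially"
    show "?a \<longlonglongrightarrow> 0"
    proof (rule order_tendstoI)
      fix a :: ereal assume "a < 0"
      then show "eventually (\<lambda>n. a < ?a n) sequentially"
        by (intro always_eventually allI less_le_trans[OF _ L1_norm_nonneg])
    next
      fix a :: ereal assume "0 < a"
      then obtain e where e: "0 < ereal e" "ereal e < a" using ereal_dense2[of 0 a] by auto
      then have "eventually (\<lambda>n. norm_le (\<lambda>\<omega>. f n \<omega> - X \<omega>) e) sequentially" using ev by simp
      then show "eventually (\<lambda>n. ?a n < a) sequentially"
        by (rule eventually_mono) (use e in \<open>auto simp: L1_norm_le_iff[symmetric] intro: le_less_trans\<close>)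
    qed
  qed
  then show ?thesis by (simp add: Cb_approx_def)
qed

lemma Cb_approx_bcontfun: "Cb_approx \<rho> f X \<Longrightarrow> f n \<in> bcontfun"
  by (simp add: Cb_approx_iff)

lemma Cb_approx_bounded_borel: "Cb_approx \<rho> f X \<Longrightarrow> f n \<in> bounded_borel"
  by (simp add: Cb_approx_iff bcontfun_bounded_borel)

text \<open>The bound survives truncation at \<open>k\<close>: if |X| or |Y| exceeds
  \<open>k\<close>, the truncated sum is already at least \<open>k\<close>, and
  \<open>C \<ge> 1\<close> keeps it so after multiplication.\<close>

lemma norm_le_lipschitz:
  assumes X: "X \<in> borel_measurable borel" "Y \<in> borel_measurable borel" "Z \<in> borel_measurable borel"
    and Z: "\<And>\<omega>. \<bar>Z \<omega>\<bar> \<le> C * (\<bar>X \<omega>\<bar> + \<bar>Y \<omega>\<bar>)" and C: "1 \<le> C"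
    and le: "norm_le X a" "norm_le Y b"
  shows "norm_le Z (C * (a + b))"
  unfolding norm_le_def
proof
  fix k :: nat
  let ?x = "\<lambda>\<omega>. min \<bar>X \<omega>\<bar> (real k)" and ?y = "\<lambda>\<omega>. min \<bar>Y \<omega>\<bar> (real k)"
  have xy: "?x \<in> bounded_borel" "?y \<in> bounded_borel" using X by (auto intro: bounded_borel_truncate)
  have "min \<bar>Z \<omega>\<bar> (real k) \<le> C * (?x \<omega> + ?y \<omega>)" for \<omega>
  proof (cases "\<bar>X \<omega>\<bar> \<le> real k \<and> \<bar>Y \<omega>\<bar> \<le> real k")
    case True
    then show ?thesis using Z[of \<omega>] by (auto simp: min_def)
  next
    case False
    then have "real k \<le> ?x \<omega> + ?y \<omega>" by (auto simp: min_def)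
    also have "\<dots> \<le> C * (?x \<omega> + ?y \<omega>)" using C mult_right_mono[of 1 C "?x \<omega> + ?y \<omega>"] by simp
    finally show ?thesis by (rule order_trans[OF min.cobounded2])
  qed
  then have "\<rho> (\<lambda>\<omega>. min \<bar>Z \<omega>\<bar> (real k)) \<le> \<rho> (\<lambda>\<omega>. C * (?x \<omega> + ?y \<omega>))"
    using X by (intro mono bounded_borel_truncate bounded_borel_scale bounded_borel_add xy) auto
  also have "\<dots> = C * \<rho> (\<lambda>\<omega>. ?x \<omega> + ?y \<omega>)" using C xy by (intro scale bounded_borel_add) auto
  also have "\<dots> \<le> C * (\<rho> ?x + \<rho> ?y)" using C by (intro mult_left_mono subadd xy) auto
  also have "\<dots> \<le> C * (a + b)" using C le by (intro mult_left_mono add_mono) (auto simp: norm_le_def)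
  finally show "\<rho> (\<lambda>\<omega>. min \<bar>Z \<omega>\<bar> (real k)) \<le> C * (a + b)" .
qed

text \<open>The common source of the closure properties of \<open>Lc1\<close>: sums, maxima and
  multiples are pointwise Lipschitz, so they can be applied to the approximating sequences.\<close>

lemma Cb_approx_lipschitz:
  assumes f: "Cb_approx \<rho> f X" "X \<in> borel_measurable borel"
    and g: "Cb_approx \<rho> g Y" "Y \<in> borel_measurable borel"
    and h: "\<And>n. h n \<in> bcontfun" "Z \<in> borel_measurable borel"
    and le: "\<And>n \<omega>. \<bar>h n \<omega> - Z \<omega>\<bar> \<le> C * (\<bar>f n \<omega> - X \<omega>\<bar> + \<bar>g n \<omega> - Y \<omega>\<bar>)" and C: "1 \<le> C"
  shows "Cb_approx \<rho> h Z"
  unfolding Cb_approx_iff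
proof (intro conjI allI impI h)
  fix e :: real assume e: "0 < e"
  let ?e = "e / (2 * C)"
  have e': "0 < ?e" using e C by simp
  have "eventually (\<lambda>n. norm_le (\<lambda>\<omega>. f n \<omega> - X \<omega>) ?e) sequentially"
    "eventually (\<lambda>n. norm_le (\<lambda>\<omega>. g n \<omega> - Y \<omega>) ?e) sequentially"
    using f(1) g(1) e' unfolding Cb_approx_iff by blast+
  then show "eventually (\<lambda>n. norm_le (\<lambda>\<omega>. h n \<omega> - Z \<omega>) e) sequentially"
  proof eventually_elim
    case (elim n)
    have "norm_le (\<lambda>\<omega>. h n \<omega> - Z \<omega>) (C * (?e + ?e))"
      using bounded_borel_measurable[OF Cb_approx_bounded_borel[OF f(1), of n]] f(2)
        bounded_borel_measurable[OF Cb_approx_bounded_borel[OF g(1), of n]] g(2)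
        bounded_borel_measurable[OF bcontfun_bounded_borel[OF h(1), of n]] h(2) le[of n] C elim
      by (intro norm_le_lipschitz[where X="\<lambda>\<omega>. f n \<omega> - X \<omega>" and Y="\<lambda>\<omega>. g n \<omega> - Y \<omega>"]) auto
    then show ?case using C by simp
  qed
qed

lemma Lc1_measurable: "X \<in> Lc1 \<rho> \<Longrightarrow> X \<in> borel_measurable borel"
  by (simp add: Lc1_def)

lemma Lc1_approx: assumes "X \<in> Lc1 \<rho>" obtains f where "Cb_approx \<rho> f X"
  using assms by (auto simp: Lc1_def)

lemma Lc1I: "X \<in> borel_measurable borel \<Longrightarrow> Cb_approx \<rho> f X \<Longrightarrow> X \<in> Lc1 \<rho>"
  by (auto simp: Lc1_def)

lemma Cb_approx_add:
  assumes f: "Cb_approx \<rho> f X" "X \<in> borel_measurable borel"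
    and g: "Cb_approx \<rho> g Y" "Y \<in> borel_measurable borel"
  shows "Cb_approx \<rho> (\<lambda>n \<omega>. f n \<omega> + g n \<omega>) (\<lambda>\<omega>. X \<omega> + Y \<omega>)"
  using f(2) g(2) Cb_approx_bcontfun[OF f(1)] Cb_approx_bcontfun[OF g(1)]
  by (intro Cb_approx_lipschitz[OF f g, where C=1] bcontfunI' continuous_on_add bounded_borel_add)
    (auto intro: bcontfun_continuous bcontfun_bounded_borel)

lemma Cb_approx_max:
  assumes f: "Cb_approx \<rho> f X" "X \<in> borel_measurable borel"
    and g: "Cb_approx \<rho> g Y" "Y \<in> borel_measurable borel"
  shows "Cb_approx \<rho> (\<lambda>n \<omega>. max (f n \<omega>) (g n \<omega>)) (\<lambda>\<omega>. max (X \<omega>) (Y \<omega>))"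
proof (intro Cb_approx_lipschitz[OF f g, where C=1] bcontfunI')
  fix n
  show "continuous_on UNIV (\<lambda>\<omega>. max (f n \<omega>) (g n \<omega>))"
    by (intro continuous_on_max bcontfun_continuous Cb_approx_bcontfun[OF f(1)] Cb_approx_bcontfun[OF g(1)])
  show "(\<lambda>\<omega>. max (f n \<omega>) (g n \<omega>)) \<in> bounded_borel"
    by (rule bounded_borel_lipschitz[OF Cb_approx_bounded_borel[OF f(1), of n]
          Cb_approx_bounded_borel[OF g(1), of n], where C=1])
      (use Cb_approx_bounded_borel[OF f(1), of n] Cb_approx_bounded_borel[OF g(1), of n] in auto)
qed (use f(2) g(2) in \<open>auto simp: max_def\<close>)

lemma Cb_approx_scale:
  assumes f: "Cb_approx \<rho> f X" "X \<in> borel_measurable borel"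
  shows "Cb_approx \<rho> (\<lambda>n \<omega>. t * f n \<omega>) (\<lambda>\<omega>. t * X \<omega>)"
proof (intro Cb_approx_lipschitz[OF f f, where C="max 1 \<bar>t\<bar>"] bcontfunI')
  fix n \<omega>
  show "continuous_on UNIV (\<lambda>\<omega>. t * f n \<omega>)"
    by (intro continuous_on_mult continuous_on_const bcontfun_continuous Cb_approx_bcontfun[OF f(1)])
  show "(\<lambda>\<omega>. t * f n \<omega>) \<in> bounded_borel" by (intro bounded_borel_scale Cb_approx_bounded_borel[OF f(1)])
  have "\<bar>t * f n \<omega> - t * X \<omega>\<bar> = \<bar>t\<bar> * \<bar>f n \<omega> - X \<omega>\<bar>"
    by (simp add: abs_mult[symmetric] right_diff_distrib)
  also have "\<dots> \<le> max 1 \<bar>t\<bar> * (\<bar>f n \<omega> - X \<omega>\<bar> + \<bar>f n \<omega> - X \<omega>\<bar>)" by (intro mult_mono) auto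
  finally show "\<bar>t * f n \<omega> - t * X \<omega>\<bar> \<le> max 1 \<bar>t\<bar> * (\<bar>f n \<omega> - X \<omega>\<bar> + \<bar>f n \<omega> - X \<omega>\<bar>)" .
qed (use f(2) in auto)

lemma Cb_approx_self: "f \<in> bcontfun \<Longrightarrow> Cb_approx \<rho> (\<lambda>_. f) f"
  by (auto simp: Cb_approx_iff norm_le_def const min_def)

lemma bcontfun_Lc1: "f \<in> bcontfun \<Longrightarrow> f \<in> Lc1 \<rho>"
  by (rule Lc1I[OF _ Cb_approx_self]) (auto dest: bcontfun_bounded_borel bounded_borel_measurable)

lemma const_bcontfun: "(\<lambda>_::'a. c::real) \<in> bcontfun"
  by (intro bcontfunI' continuous_on_const bounded_borel_const)

lemma Lc1_const: "(\<lambda>_. c) \<in> Lc1 \<rho>"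
  by (intro bcontfun_Lc1 const_bcontfun)

lemma Lc1_function_space: "function_space (Lc1 \<rho>)"
  unfolding function_space_def
proof (intro conjI ballI allI)
  show "Lc1 \<rho> \<noteq> {}" using Lc1_const by auto
  fix X assume X: "X \<in> Lc1 \<rho>"
  obtain f where f: "Cb_approx \<rho> f X" by (rule Lc1_approx[OF X])
  note Xm = Lc1_measurable[OF X]
  show "(\<lambda>\<omega>. t * X \<omega>) \<in> Lc1 \<rho>" for t
    by (rule Lc1I[OF _ Cb_approx_scale[OF f Xm]]) (use Xm in auto)
  fix Y assume Y: "Y \<in> Lc1 \<rho>"
  obtain g where g: "Cb_approx \<rho> g Y" by (rule Lc1_approx[OF Y])
  show "(\<lambda>\<omega>. X \<omega> + Y \<omega>) \<in> Lc1 \<rho>"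
    by (rule Lc1I[OF _ Cb_approx_add[OF f Xm g Lc1_measurable[OF Y]]]) (use Xm Lc1_measurable[OF Y] in auto)
qed

lemma Lc1_max: assumes X: "X \<in> Lc1 \<rho>" and Y: "Y \<in> Lc1 \<rho>" shows "(\<lambda>\<omega>. max (X \<omega>) (Y \<omega>)) \<in> Lc1 \<rho>"
proof -
  obtain f where f: "Cb_approx \<rho> f X" by (rule Lc1_approx[OF X])
  obtain g where g: "Cb_approx \<rho> g Y" by (rule Lc1_approx[OF Y])
  show ?thesis
    by (rule Lc1I[OF _ Cb_approx_max[OF f Lc1_measurable[OF X] g Lc1_measurable[OF Y]]])
      (use Lc1_measurable[OF X] Lc1_measurable[OF Y] in auto)
qed

lemma Lc1_abs: assumes "X \<in> Lc1 \<rho>" shows "(\<lambda>\<omega>. \<bar>X \<omega>\<bar>) \<in> Lc1 \<rho>"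
proof -
  have "(\<lambda>\<omega>. \<bar>X \<omega>\<bar>) = (\<lambda>\<omega>. max (X \<omega>) (- X \<omega>))" by (auto simp: max_def)
  then show ?thesis
    using Lc1_max[OF assms function_space_uminus[OF Lc1_function_space assms]] by simp
qed

text \<open>The truncated |Y| is at most the truncated |X| plus \<open>k\<close> times the indicator
  of \<open>N\<close>, and the latter has expectation 0.\<close>

lemma norm_le_cong_polar:
  assumes N: "polar \<rho> N" and X: "X \<in> borel_measurable borel" "Y \<in> borel_measurable borel"
    and eq: "\<And>\<omega>. \<omega> \<notin> N \<Longrightarrow> X \<omega> = Y \<omega>" and le: "norm_le X e"
  shows "norm_le Y e"
  unfolding norm_le_def
proof
  fix k :: nat
  have N': "indicator N \<in> bounded_borel" "\<rho> (indicator N) = 0"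
    using N by (auto simp: polar_def bounded_borel_indicator)
  have "\<rho> (\<lambda>\<omega>. min \<bar>Y \<omega>\<bar> (real k)) \<le> \<rho> (\<lambda>\<omega>. min \<bar>X \<omega>\<bar> (real k) + real k * indicator N \<omega>)"
    using X eq by (intro mono bounded_borel_add bounded_borel_truncate bounded_borel_scale N')
      (auto split: split_indicator)
  also have "\<dots> \<le> \<rho> (\<lambda>\<omega>. min \<bar>X \<omega>\<bar> (real k)) + \<rho> (\<lambda>\<omega>. real k * indicator N \<omega>)"
    using X N' by (intro subadd bounded_borel_truncate bounded_borel_scale)
  also have "\<dots> \<le> e" using le N' scale[OF N'(1), of "real k"] by (simp add: norm_le_def)
  finally show "\<rho> (\<lambda>\<omega>. min \<bar>Y \<omega>\<bar> (real k)) \<le> e" .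
qed

lemma Cb_approx_cong_polar:
  assumes N: "polar \<rho> N" and X: "X \<in> borel_measurable borel" "Y \<in> borel_measurable borel"
    and eq: "\<And>\<omega>. \<omega> \<notin> N \<Longrightarrow> X \<omega> = Y \<omega>" and f: "Cb_approx \<rho> f X"
  shows "Cb_approx \<rho> f Y"
proof -
  have "norm_le (\<lambda>\<omega>. f n \<omega> - Y \<omega>) e" if "norm_le (\<lambda>\<omega>. f n \<omega> - X \<omega>) e" for n e
    by (rule norm_le_cong_polar[OF N _ _ _ that])
      (use X eq bounded_borel_measurable[OF Cb_approx_bounded_borel[OF f, of n]] in auto)
  then show ?thesis using f unfolding Cb_approx_iff by (meson eventually_mono)
qed

text \<open>Such an indicator is a representative of zero. Its membership in \<open>Lc1\<close> is
  what later lets a dominated probability be tested on polar sets.\<close>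

lemma polar_Lc1: assumes "polar \<rho> N" shows "indicator N \<in> Lc1 \<rho>" "Cb_approx \<rho> (\<lambda>_ _. 0) (indicator N)"
proof -
  have N: "N \<in> sets borel" using assms by (simp add: polar_def)
  show *: "Cb_approx \<rho> (\<lambda>_ _. 0) (indicator N)"
    by (rule Cb_approx_cong_polar[OF assms _ _ _ Cb_approx_self[OF const_bcontfun[of 0]]])
      (use N in \<open>auto simp: indicator_def\<close>)
  show "indicator N \<in> Lc1 \<rho>" by (rule Lc1I[OF _ *]) (use N in auto)
qed

lemma polar_empty: "polar \<rho> {}"
proof -
  have "indicat_real {} = (\<lambda>_::'a. 0)" by auto
  then show ?thesis using const[of 0] by (simp add: polar_def)
qed

end

text \<open>Used with \<open>\<rho>\<^sub>1\<close> and with \<open>\<rho>\<^sub>2\<close> in the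
  place of \<open>\<phi>\<close>, both below their maximum \<rho>.\<close>

locale dominated_expectation = sublinear_expectation_on \<rho> + \<phi>: sublinear_expectation_on \<phi>
  for \<rho> \<phi> :: "('a::topological_space \<Rightarrow> real) \<Rightarrow> real" +
  assumes dominated: "\<And>X. X \<in> bounded_borel \<Longrightarrow> \<phi> X \<le> \<rho> X"
begin

abbreviation ext :: "('a \<Rightarrow> real) \<Rightarrow> real" where "ext \<equiv> Lc1_ext \<rho> \<phi>"

text \<open>The contraction estimate behind the extension: \<open>\<phi> f - \<phi> g \<le> \<phi>
  (f - g) \<le> \<rho> \<bar>f - g\<bar>\<close>. As \<open>f - g\<close> is bounded, a large
  truncation level leaves it unchanged, and the triangle inequality through \<open>X\<close>
  finishes.\<close>

lemma diff_le:
  assumes "f \<in> bounded_borel" "g \<in> bounded_borel"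
    and "X \<in> borel_measurable borel" "norm_le (\<lambda>\<omega>. f \<omega> - X \<omega>) a" "norm_le (\<lambda>\<omega>. g \<omega> - X \<omega>) b"
  shows "\<phi> f - \<phi> g \<le> a + b"
proof -
  have fg: "(\<lambda>\<omega>. f \<omega> - g \<omega>) \<in> bounded_borel" using assms by (intro bounded_borel_diff)
  obtain k where k: "\<And>\<omega>. \<bar>f \<omega> - g \<omega>\<bar> \<le> real k" using bounded_borel_bound[OF fg] by auto
  have "\<phi> f = \<phi> (\<lambda>\<omega>. (f \<omega> - g \<omega>) + g \<omega>)" by simp
  also have "\<dots> \<le> \<phi> (\<lambda>\<omega>. f \<omega> - g \<omega>) + \<phi> g" by (intro \<phi>.subadd fg assms)
  also have "\<phi> (\<lambda>\<omega>. f \<omega> - g \<omega>) \<le> \<phi> (\<lambda>\<omega>. \<bar>f \<omega> - g \<omega>\<bar>)"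
    by (intro \<phi>.mono fg bounded_borel_abs) auto
  also have "\<dots> \<le> \<rho> (\<lambda>\<omega>. \<bar>f \<omega> - g \<omega>\<bar>)" by (intro dominated bounded_borel_abs fg)
  also have "\<dots> = \<rho> (\<lambda>\<omega>. min \<bar>f \<omega> - g \<omega>\<bar> (real k))" using k by (simp add: min_absorb1)
  also have "\<dots> \<le> a + b"
  proof -
    have "norm_le (\<lambda>\<omega>. f \<omega> - g \<omega>) (1 * (a + b))"
      using assms by (intro norm_le_lipschitz[where X="\<lambda>\<omega>. f \<omega> - X \<omega>" and Y="\<lambda>\<omega>. g \<omega> - X \<omega>"]) auto
    then show ?thesis by (simp add: norm_le_def)
  qed
  finally show ?thesis by simp
qed

text \<open>With \<open>g = f\<close> this is the Cauchy property; with two different sequences it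
  shows that their limits coincide.\<close>

lemma approx_diff_tendsto:
  assumes f: "Cb_approx \<rho> f X" and g: "Cb_approx \<rho> g X" and X: "X \<in> borel_measurable borel" and e: "0 < e"
  shows "\<exists>N. \<forall>m\<ge>N. \<forall>n\<ge>N. \<bar>\<phi> (f m) - \<phi> (g n)\<bar> < e"
proof -
  have "0 < e / 3" using e by simp
  then have "eventually (\<lambda>n. norm_le (\<lambda>\<omega>. f n \<omega> - X \<omega>) (e/3)) sequentially"
    "eventually (\<lambda>n. norm_le (\<lambda>\<omega>. g n \<omega> - X \<omega>) (e/3)) sequentially"
    using f g by (simp_all add: Cb_approx_iff)
  then obtain N1 N2 where N1: "\<And>n. N1 \<le> n \<Longrightarrow> norm_le (\<lambda>\<omega>. f n \<omega> - X \<omega>) (e/3)"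
    and N2: "\<And>n. N2 \<le> n \<Longrightarrow> norm_le (\<lambda>\<omega>. g n \<omega> - X \<omega>) (e/3)"
    unfolding eventually_sequentially by blast
  have "\<bar>\<phi> (f m) - \<phi> (g n)\<bar> < e" if "max N1 N2 \<le> m" "max N1 N2 \<le> n" for m n
  proof -
    have "\<phi> (f m) - \<phi> (g n) \<le> e/3 + e/3" "\<phi> (g n) - \<phi> (f m) \<le> e/3 + e/3"
      using that by (intro diff_le[OF _ _ X] Cb_approx_bounded_borel[OF f] Cb_approx_bounded_borel[OF g] N1 N2; simp)+
    then show ?thesis using e by linarith
  qed
  then show ?thesis by blast
qed

text \<open>Discharges the definite description in \<open>Lc1_ext\<close>: the Cauchy property gives
  a limit, and all approximating sequences share it.\<close>

lemma ext_tendsto: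
  assumes f: "Cb_approx \<rho> f X" and X: "X \<in> borel_measurable borel"
  shows "(\<lambda>n. \<phi> (f n)) \<longlonglongrightarrow> ext X"
proof -
  have "Cauchy (\<lambda>n. \<phi> (f n))"
    using approx_diff_tendsto[OF f f X] by (auto simp: Cauchy_def dist_real_def)
  then obtain l where l: "(\<lambda>n. \<phi> (f n)) \<longlonglongrightarrow> l" using Cauchy_convergent convergent_def by blast
  have all: "(\<lambda>n. \<phi> (g n)) \<longlonglongrightarrow> l" if g: "Cb_approx \<rho> g X" for g
  proof -
    have "(\<lambda>n. \<phi> (g n) - \<phi> (f n)) \<longlonglongrightarrow> 0"
      using approx_diff_tendsto[OF g f X] by (intro LIMSEQ_I) (force simp: real_norm_def)
    from tendsto_add[OF this l] show ?thesis by simp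
  qed
  have "ext X = l"
    unfolding Lc1_ext_def
    by (rule the_equality) (use all LIMSEQ_unique[OF l] f in auto)
  with l show ?thesis by simp
qed

text \<open>A conjugate is superadditive, so this locale does not treat it directly; its extension
  is computed along \<open>- f n\<close>, which approximates \<open>- X\<close>.\<close>

lemma ext_conjugate:
  assumes X: "X \<in> Lc1 \<rho>" shows "Lc1_ext \<rho> (conjugate \<phi>) X = - ext (\<lambda>\<omega>. - X \<omega>)"
proof -
  note Xm = Lc1_measurable[OF X]
  have all: "(\<lambda>n. conjugate \<phi> (g n)) \<longlonglongrightarrow> - ext (\<lambda>\<omega>. - X \<omega>)" if g: "Cb_approx \<rho> g X" for g
    using tendsto_minus[OF ext_tendsto[OF Cb_approx_scale[OF g Xm, of "-1"]]] Xm
    by (simp add: conjugate_def)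
  obtain f where f: "Cb_approx \<rho> f X" by (rule Lc1_approx[OF X])
  show ?thesis
    unfolding Lc1_ext_def[of \<rho> "conjugate \<phi>"]
    by (rule the_equality) (use all LIMSEQ_unique[OF all[OF f]] f in auto)
qed

lemma ext_bcontfun: "f \<in> bcontfun \<Longrightarrow> ext f = \<phi> f"
  using ext_tendsto[OF Cb_approx_self, of f] bcontfun_bounded_borel[of f]
  by (auto dest: bounded_borel_measurable intro: LIMSEQ_unique[OF _ tendsto_const])

lemma ext_const: "ext (\<lambda>_. c) = c"
  by (simp add: ext_bcontfun const_bcontfun \<phi>.const)

lemma ext_sublinear: "sublinear_on (Lc1 \<rho>) ext"
  unfolding sublinear_on_def
proof (intro conjI ballI allI impI)
  fix X assume X: "X \<in> Lc1 \<rho>"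
  obtain f where f: "Cb_approx \<rho> f X" by (rule Lc1_approx[OF X])
  note Xm = Lc1_measurable[OF X]
  show "ext (\<lambda>\<omega>. t * X \<omega>) \<le> t * ext X" if "0 \<le> t" for t
  proof -
    have "(\<lambda>n. \<phi> (\<lambda>\<omega>. t * f n \<omega>)) \<longlonglongrightarrow> ext (\<lambda>\<omega>. t * X \<omega>)"
      using Xm by (intro ext_tendsto Cb_approx_scale f) auto
    then have "(\<lambda>n. t * \<phi> (f n)) \<longlonglongrightarrow> ext (\<lambda>\<omega>. t * X \<omega>)"
      by (simp add: \<phi>.scale[OF Cb_approx_bounded_borel[OF f] that])
    then have "ext (\<lambda>\<omega>. t * X \<omega>) = t * ext X"
      by (rule LIMSEQ_unique) (intro tendsto_mult_left ext_tendsto f Xm)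
    then show ?thesis by simp
  qed
  fix Y assume Y: "Y \<in> Lc1 \<rho>"
  obtain g where g: "Cb_approx \<rho> g Y" by (rule Lc1_approx[OF Y])
  note Ym = Lc1_measurable[OF Y]
  show "ext (\<lambda>\<omega>. X \<omega> + Y \<omega>) \<le> ext X + ext Y"
  proof (rule LIMSEQ_le)
    show "(\<lambda>n. \<phi> (\<lambda>\<omega>. f n \<omega> + g n \<omega>)) \<longlonglongrightarrow> ext (\<lambda>\<omega>. X \<omega> + Y \<omega>)"
      using Xm Ym by (intro ext_tendsto Cb_approx_add f g) auto
    show "(\<lambda>n. \<phi> (f n) + \<phi> (g n)) \<longlonglongrightarrow> ext X + ext Y"
      by (intro tendsto_add ext_tendsto f g Xm Ym)
    show "\<exists>N. \<forall>n\<ge>N. \<phi> (\<lambda>\<omega>. f n \<omega> + g n \<omega>) \<le> \<phi> (f n) + \<phi> (g n)"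
      using \<phi>.subadd Cb_approx_bounded_borel[OF f] Cb_approx_bounded_borel[OF g] by blast
  qed
qed

lemma ext_cong_quasi_surely:
  assumes N: "polar \<rho> N" and X: "X \<in> Lc1 \<rho>" "Y \<in> borel_measurable borel"
    and eq: "\<And>\<omega>. \<omega> \<notin> N \<Longrightarrow> X \<omega> = Y \<omega>"
  shows "ext Y = ext X"
proof -
  obtain f where f: "Cb_approx \<rho> f X" by (rule Lc1_approx[OF X(1)])
  have "Cb_approx \<rho> f Y" by (rule Cb_approx_cong_polar[OF N Lc1_measurable[OF X(1)] X(2) eq f])
  from ext_tendsto[OF this X(2)] ext_tendsto[OF f Lc1_measurable[OF X(1)]]
  show ?thesis by (rule LIMSEQ_unique)
qed

text \<open>Approximants of \<open>X\<close> and \<open>Y\<close> need not be ordered. Replacing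
  \<open>g n\<close> by \<open>max (f n) (g n)\<close> orders them, and the new limit
  \<open>max X Y\<close> is quasi-surely \<open>Y\<close>.\<close>

lemma ext_mono_quasi_surely:
  assumes X: "X \<in> Lc1 \<rho>" and Y: "Y \<in> Lc1 \<rho>" and le: "quasi_surely \<rho> (\<lambda>\<omega>. X \<omega> \<le> Y \<omega>)"
  shows "ext X \<le> ext Y"
proof -
  obtain N where N: "polar \<rho> N" "\<And>\<omega>. \<omega> \<notin> N \<Longrightarrow> X \<omega> \<le> Y \<omega>" using le by (auto simp: quasi_surely_def)
  obtain f where f: "Cb_approx \<rho> f X" by (rule Lc1_approx[OF X])
  obtain g where g: "Cb_approx \<rho> g Y" by (rule Lc1_approx[OF Y])
  note Xm = Lc1_measurable[OF X] and Ym = Lc1_measurable[OF Y]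
  have m: "Cb_approx \<rho> (\<lambda>n \<omega>. max (f n \<omega>) (g n \<omega>)) (\<lambda>\<omega>. max (X \<omega>) (Y \<omega>))"
    by (rule Cb_approx_max[OF f Xm g Ym])
  have "ext X \<le> ext (\<lambda>\<omega>. max (X \<omega>) (Y \<omega>))"
  proof (rule LIMSEQ_le)
    show "(\<lambda>n. \<phi> (f n)) \<longlonglongrightarrow> ext X" by (rule ext_tendsto[OF f Xm])
    show "(\<lambda>n. \<phi> (\<lambda>\<omega>. max (f n \<omega>) (g n \<omega>))) \<longlonglongrightarrow> ext (\<lambda>\<omega>. max (X \<omega>) (Y \<omega>))"
      using Xm Ym by (intro ext_tendsto[OF m]) auto
    show "\<exists>N. \<forall>n\<ge>N. \<phi> (f n) \<le> \<phi> (\<lambda>\<omega>. max (f n \<omega>) (g n \<omega>))"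
      using \<phi>.mono[OF Cb_approx_bounded_borel[OF f] Cb_approx_bounded_borel[OF m]] by auto
  qed
  also have "ext (\<lambda>\<omega>. max (X \<omega>) (Y \<omega>)) = ext Y"
    by (rule ext_cong_quasi_surely[OF N(1) Y]) (use Xm Ym N(2) in \<open>auto simp: max_def\<close>)
  finally show ?thesis .
qed

lemma quasi_surelyI: "(\<And>\<omega>. \<psi> \<omega>) \<Longrightarrow> quasi_surely \<rho> \<psi>"
  using polar_empty by (auto simp: quasi_surely_def)

lemma ext_mono: "X \<in> Lc1 \<rho> \<Longrightarrow> Y \<in> Lc1 \<rho> \<Longrightarrow> (\<And>\<omega>. X \<omega> \<le> Y \<omega>) \<Longrightarrow> ext X \<le> ext Y"
  by (intro ext_mono_quasi_surely quasi_surelyI)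

lemma ext_polar: "polar \<rho> N \<Longrightarrow> ext (indicator N) = 0"
  using ext_tendsto[OF polar_Lc1(2)] \<phi>.const[of 0]
  by (auto simp: polar_def intro: LIMSEQ_unique[OF _ tendsto_const])

end

section \<open>Threshold tests for two probability measures\<close>

lemma open_superset_small:
  fixes M :: "'a::polish_space measure"
  assumes M: "finite_measure M" "sets M = sets borel" and A: "A \<in> sets borel" and e: "0 < (e::real)"
  shows "\<exists>U. open U \<and> A \<subseteq> U \<and> measure M (U - A) < e"
proof -
  interpret finite_measure M by (rule M)
  have "emeasure M A = (INF U\<in>{U. A \<subseteq> U \<and> open U}. emeasure M U)"
    using M(2) A emeasure_finite by (intro outer_regular) auto
  moreover have "emeasure M A < ennreal (measure M A + e)"
    using e by (simp add: emeasure_eq_measure ennreal_less_iff)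
  ultimately obtain U where U: "A \<subseteq> U" "open U" "emeasure M U < ennreal (measure M A + e)"
    by (auto simp: INF_less_iff)
  then have "measure M (U - A) < e"
    using A M(2) by (subst finite_measure_Diff) (auto simp: emeasure_eq_measure ennreal_less_iff)
  with U show ?thesis by blast
qed

text \<open>One function must serve both measures: intersecting two open supersets, each small for
  its own measure, gives a \<open>U\<close> small for both, and the indicator of \<open>U\<close> is
  a limit of continuous functions of the distance to its complement.\<close>

lemma continuous_approx_indicator:
  fixes M N :: "'a::polish_space measure"
  assumes M: "finite_measure M" "sets M = sets borel" and N: "finite_measure N" "sets N = sets borel"
    and A: "A \<in> sets borel" and e: "0 < (e::real)"
  shows "\<exists>f. continuous_on UNIV f \<and> (\<forall>\<omega>. 0 \<le> f \<omega> \<and> f \<omega> \<le> 1) \<and>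
    (\<integral>\<omega>. \<bar>f \<omega> - indicator A \<omega>\<bar> \<partial>M) < e \<and> (\<integral>\<omega>. \<bar>f \<omega> - indicator A \<omega>\<bar> \<partial>N) < e"
proof -
  obtain U1 where U1: "open U1" "A \<subseteq> U1" "measure M (U1 - A) < e/2"
    using open_superset_small[OF M A, of "e/2"] e by auto
  obtain U2 where U2: "open U2" "A \<subseteq> U2" "measure N (U2 - A) < e/2"
    using open_superset_small[OF N A, of "e/2"] e by auto
  define U where "U = U1 \<inter> U2"
  have U: "open U" "A \<subseteq> U" using U1 U2 by (auto simp: U_def)
  \<comment> \<open>\<open>infdist\<close> to the empty set is 0 by convention, which would give the
    wrong limit for \<open>U = UNIV\<close>.\<close>
  define f where "f n \<omega> = (if U = UNIV then 1 else min 1 (real n * infdist \<omega> (- U)))" for n :: nat and \<omega>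
  have cont: "continuous_on UNIV (f n)" for n
    unfolding f_def by (cases "U = UNIV") (auto intro!: continuous_intros)
  have bounds: "0 \<le> f n \<omega>" "f n \<omega> \<le> 1" for n \<omega> by (auto simp: f_def infdist_nonneg)
  have [measurable]: "f n \<in> borel_measurable borel" for n
    using cont by (rule borel_measurable_continuous_onI)
  have [measurable]: "U \<in> sets borel" "A \<in> sets borel" using U A by auto
  have lim: "(\<lambda>n. \<bar>f n \<omega> - indicator U \<omega>\<bar>) \<longlonglongrightarrow> 0" for \<omega>
  proof (cases "U = UNIV")
    case True
    then show ?thesis by (simp add: f_def)
  next
    case False
    show ?thesis
    proof (cases "\<omega> \<in> U")
      case True
      moreover have "closed (- U)" "- U \<noteq> {}" using False U by auto
      ultimately have "0 < infdist \<omega> (- U)"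
        using U in_closed_iff_infdist_zero[of "- U" \<omega>] infdist_nonneg[of \<omega> "- U"] by auto
      moreover obtain n0 :: nat where "1 / infdist \<omega> (- U) < real n0" using reals_Archimedean2 by blast
      ultimately have n0: "0 < infdist \<omega> (- U)" "1 \<le> real n0 * infdist \<omega> (- U)"
        by (auto simp: field_simps)
      have "f n \<omega> = 1" if "n0 \<le> n" for n
      proof -
        have "real n0 * infdist \<omega> (- U) \<le> real n * infdist \<omega> (- U)"
          using that n0 by (intro mult_right_mono) auto
        then have "1 \<le> real n * infdist \<omega> (- U)" using n0 by linarith
        then show ?thesis using False by (simp add: f_def min_absorb1)
      qed
      then show ?thesis using True
        by (intro tendsto_eventually eventually_sequentiallyI[of n0]) simp
    next
      case nU: False
      then have "infdist \<omega> (- U) = 0" by simp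
      then show ?thesis using False nU by (simp add: f_def)
    qed
  qed
  have conv: "eventually (\<lambda>n. (\<integral>\<omega>. \<bar>f n \<omega> - indicator A \<omega>\<bar> \<partial>L) < e) sequentially"
    if L: "finite_measure L" "sets L = sets borel" "measure L (U - A) < e/2" for L :: "'a measure"
  proof -
    interpret finite_measure L by (rule L)
    have [measurable_cong]: "sets L = sets borel" by (rule L)
    have i1: "integrable L (\<lambda>\<omega>. \<bar>f n \<omega> - indicator U \<omega>\<bar>)" for n
      using bounds by (intro integrable_const_bound[of _ 1]) (auto split: split_indicator)
    have i2: "integrable L (\<lambda>\<omega>. indicator (U - A) \<omega> :: real)"
      by (intro integrable_const_bound[of _ 1]) (auto split: split_indicator)
    have "(\<lambda>n. \<integral>\<omega>. \<bar>f n \<omega> - indicator U \<omega>\<bar> \<partial>L) \<longlonglongrightarrow> (\<integral>\<omega>. 0 \<partial>L)"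
      by (rule integral_dominated_convergence[where w="\<lambda>_. 1"])
        (use lim bounds in \<open>auto split: split_indicator\<close>)
    then have "eventually (\<lambda>n. (\<integral>\<omega>. \<bar>f n \<omega> - indicator U \<omega>\<bar> \<partial>L) < e/2) sequentially"
      using e by (intro order_tendstoD(2)) auto
    then show ?thesis
    proof eventually_elim
      case (elim n)
      have "(\<integral>\<omega>. \<bar>f n \<omega> - indicator A \<omega>\<bar> \<partial>L)
          \<le> (\<integral>\<omega>. \<bar>f n \<omega> - indicator U \<omega>\<bar> + indicator (U - A) \<omega> \<partial>L)"
        using U(2) bounds i1 i2
        by (intro integral_mono Bochner_Integration.integrable_add integrable_const_bound[of _ 1])
          (auto split: split_indicator)
      also have "\<dots> = (\<integral>\<omega>. \<bar>f n \<omega> - indicator U \<omega>\<bar> \<partial>L) + measure L (U - A)"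
        using i1 i2 sets_eq_imp_space_eq[OF L(2)] by simp
      finally show ?case using elim L(3) by simp
    qed
  qed
  interpret M: finite_measure M by (rule M)
  interpret N: finite_measure N by (rule N)
  have "measure M (U - A) \<le> measure M (U1 - A)" "measure N (U - A) \<le> measure N (U2 - A)"
    using U1 U2 M(2) N(2) A unfolding U_def
    by (auto intro!: M.finite_measure_mono N.finite_measure_mono)
  then have "eventually (\<lambda>n. (\<integral>\<omega>. \<bar>f n \<omega> - indicator A \<omega>\<bar> \<partial>M) < e \<and>
      (\<integral>\<omega>. \<bar>f n \<omega> - indicator A \<omega>\<bar> \<partial>N) < e) sequentially"
    using U1(3) U2(3) by (intro eventually_conj conv M N) auto
  then obtain n where "(\<integral>\<omega>. \<bar>f n \<omega> - indicator A \<omega>\<bar> \<partial>M) < e"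
      "(\<integral>\<omega>. \<bar>f n \<omega> - indicator A \<omega>\<bar> \<partial>N) < e"
    unfolding eventually_sequentially by blast
  with cont[of n] bounds[of n] show ?thesis by blast
qed

locale two_probabilities =
  fixes P Q :: "'a::polish_space measure"
  assumes prob_P: "prob_space P" and sets_P: "sets P = sets borel"
    and prob_Q: "prob_space Q" and sets_Q: "sets Q = sets borel"
begin

sublocale P: prob_space P by (rule prob_P)
sublocale Q: prob_space Q by (rule prob_Q)

abbreviation "K \<equiv> mean_measure P Q"
abbreviation "H \<equiv> \<lambda>\<omega>. enn2real (RN_deriv K Q \<omega>)"
abbreviation "G \<equiv> \<lambda>\<omega>. enn2real (RN_deriv K P \<omega>)"

lemma space_P: "space P = UNIV" and space_Q: "space Q = UNIV"
  using sets_eq_imp_space_eq[OF sets_P] sets_eq_imp_space_eq[OF sets_Q] by auto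

lemma sets_K [measurable_cong]: "sets K = sets borel"
  unfolding mean_measure_def by (metis sets.sigma_algebra_axioms sigma_algebra.sets_measure_of_eq space_borel)

lemma space_K: "space K = UNIV"
  using sets_eq_imp_space_eq[OF sets_K] by simp

lemma emeasure_K:
  assumes A: "A \<in> sets borel" shows "emeasure K A = (emeasure P A + emeasure Q A) / 2"
  unfolding mean_measure_def
proof (rule emeasure_measure_of_sigma)
  show "sigma_algebra UNIV (sets (borel :: 'a measure))"
    using sets.sigma_algebra_axioms[of "borel :: 'a measure"] by simp
  show "positive (sets borel) (\<lambda>A. (emeasure P A + emeasure Q A) / 2)" by (simp add: positive_def)
  show "countably_additive (sets borel) (\<lambda>A. (emeasure P A + emeasure Q A) / 2)"
  proof (rule countably_additiveI)
    fix B :: "nat \<Rightarrow> 'a set" assume B: "range B \<subseteq> sets borel" "disjoint_family B"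
    have "(\<Sum>i. (emeasure P (B i) + emeasure Q (B i)) / 2) = (\<Sum>i. emeasure P (B i) + emeasure Q (B i)) / 2"
      by simp
    also have "(\<Sum>i. emeasure P (B i) + emeasure Q (B i)) = (\<Sum>i. emeasure P (B i)) + (\<Sum>i. emeasure Q (B i))"
      by (intro suminf_add[symmetric]) auto
    also have "\<dots> = emeasure P (\<Union> (range B)) + emeasure Q (\<Union> (range B))"
      using B sets_P sets_Q by (simp add: suminf_emeasure)
    finally show "(\<Sum>i. (emeasure P (B i) + emeasure Q (B i)) / 2)
        = (emeasure P (\<Union> (range B)) + emeasure Q (\<Union> (range B))) / 2" .
  qed
qed (rule A)

sublocale K: finite_measure K
proof
  show "emeasure K (space K) \<noteq> \<infinity>"
    by (simp add: space_K emeasure_K ennreal_divide_eq_top_iff)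
qed

lemma null_K_iff: assumes A: "A \<in> sets borel"
  shows "emeasure K A = 0 \<longleftrightarrow> emeasure P A = 0 \<and> emeasure Q A = 0"
  by (simp add: emeasure_K[OF A])

lemma ac_P: "absolutely_continuous K P" and ac_Q: "absolutely_continuous K Q"
  by (auto simp: absolutely_continuous_def null_sets_def sets_K sets_P sets_Q null_K_iff)

lemma AE_K_I:
  assumes "AE \<omega> in P. \<phi> \<omega>" "AE \<omega> in Q. \<phi> \<omega>" shows "AE \<omega> in K. \<phi> \<omega>"
proof -
  obtain N1 where N1: "N1 \<in> null_sets P" "{\<omega>. \<not> \<phi> \<omega>} \<subseteq> N1"
    using assms(1) by (auto simp: eventually_ae_filter space_P)
  obtain N2 where N2: "N2 \<in> null_sets Q" "{\<omega>. \<not> \<phi> \<omega>} \<subseteq> N2"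
    using assms(2) by (auto simp: eventually_ae_filter space_Q)
  have "N1 \<inter> N2 \<in> null_sets K"
    using N1(1) N2(1) emeasure_mono[of "N1 \<inter> N2" N1 P] emeasure_mono[of "N1 \<inter> N2" N2 Q]
    by (auto simp: null_sets_def sets_K sets_P sets_Q null_K_iff)
  then show ?thesis by (rule AE_I') (use N1(2) N2(2) in auto)
qed

text \<open>Passing to real values by \<open>enn2real\<close> loses nothing, since the derivative is
  finite almost everywhere.\<close>

lemma density_H: "Q = density K (\<lambda>\<omega>. ennreal (H \<omega>))"
proof -
  have "AE \<omega> in K. RN_deriv K Q \<omega> \<noteq> \<infinity>"
    using ac_Q sets_Q sets_K Q.sigma_finite_measure_axioms by (intro K.RN_deriv_finite) auto
  then have "density K (\<lambda>\<omega>. ennreal (H \<omega>)) = density K (RN_deriv K Q)"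
    by (intro density_cong) (auto simp: less_top elim: eventually_mono)
  then show ?thesis using K.density_RN_deriv[OF ac_Q] sets_Q sets_K by simp
qed

lemma density_G: "P = density K (\<lambda>\<omega>. ennreal (G \<omega>))"
proof -
  have "AE \<omega> in K. RN_deriv K P \<omega> \<noteq> \<infinity>"
    using ac_P sets_P sets_K P.sigma_finite_measure_axioms by (intro K.RN_deriv_finite) auto
  then have "density K (\<lambda>\<omega>. ennreal (G \<omega>)) = density K (RN_deriv K P)"
    by (intro density_cong) (auto simp: less_top elim: eventually_mono)
  then show ?thesis using K.density_RN_deriv[OF ac_P] sets_P sets_K by simp
qed

lemma H_measurable [measurable]: "H \<in> borel_measurable borel"
  and G_measurable [measurable]: "G \<in> borel_measurable borel"
  using borel_measurable_RN_deriv[of K Q] borel_measurable_RN_deriv[of K P]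
  by (auto cong: measurable_cong_sets[OF sets_K refl] simp: measurable_cong_sets[OF sets_K refl])

lemma integral_Q:
  assumes [measurable]: "Y \<in> borel_measurable borel"
  shows "integral\<^sup>L Q Y = (\<integral>\<omega>. H \<omega> * Y \<omega> \<partial>K)" "integrable Q Y \<longleftrightarrow> integrable K (\<lambda>\<omega>. H \<omega> * Y \<omega>)"
proof -
  show "integral\<^sup>L Q Y = (\<integral>\<omega>. H \<omega> * Y \<omega> \<partial>K)"
    by (subst (1) density_H, rule integral_real_density) auto
  show "integrable Q Y \<longleftrightarrow> integrable K (\<lambda>\<omega>. H \<omega> * Y \<omega>)"
    by (subst (1) density_H, rule integrable_real_density) auto
qed

lemma integral_P:
  assumes [measurable]: "Y \<in> borel_measurable borel"
  shows "integral\<^sup>L P Y = (\<integral>\<omega>. G \<omega> * Y \<omega> \<partial>K)" "integrable P Y \<longleftrightarrow> integrable K (\<lambda>\<omega>. G \<omega> * Y \<omega>)"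
proof -
  show "integral\<^sup>L P Y = (\<integral>\<omega>. G \<omega> * Y \<omega> \<partial>K)"
    by (subst (1) density_G, rule integral_real_density) auto
  show "integrable P Y \<longleftrightarrow> integrable K (\<lambda>\<omega>. G \<omega> * Y \<omega>)"
    by (subst (1) density_G, rule integrable_real_density) auto
qed

text \<open>Optimality is assumed against continuous tests only and is carried to the indicator
  \<open>I\<close> of \<open>{G < \<kappa> H}\<close> by approximation. Then
  \<open>(\<kappa> H - G) (I - X)\<close> is nonnegative with nonpositive \<open>K\<close>-integral,
  so it vanishes and \<open>X = I\<close> off the tie set. On ties \<open>X\<close> is its own
  value; clipping it to [0,1] makes the bounds hold everywhere and alters it only on a null
  set.\<close>

lemma threshold_test_finite:
  assumes [measurable]: "X \<in> borel_measurable borel"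
    and XP: "AE \<omega> in P. 0 \<le> X \<omega> \<and> X \<omega> \<le> 1" and XQ: "AE \<omega> in Q. 0 \<le> X \<omega> \<and> X \<omega> \<le> 1"
    and opt: "\<And>Y. continuous_on UNIV Y \<Longrightarrow> (\<And>\<omega>. 0 \<le> Y \<omega> \<and> Y \<omega> \<le> 1) \<Longrightarrow>
      integral\<^sup>L P X - \<kappa> * integral\<^sup>L Q X \<le> integral\<^sup>L P Y - \<kappa> * integral\<^sup>L Q Y"
  shows "AE \<omega> in K. X \<omega> = threshold_test (ereal \<kappa>) H G (\<lambda>\<omega>. max 0 (min 1 (X \<omega>))) \<omega>"
proof -
  let ?A = "{\<omega>. G \<omega> < \<kappa> * H \<omega>}" and ?I = "indicator {\<omega>. G \<omega> < \<kappa> * H \<omega>} :: 'a \<Rightarrow> real"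
  have A [measurable]: "?A \<in> sets borel" by measurable
  note [measurable_cong] = sets_P sets_Q
  have int: "integrable P X" "integrable Q X" "integrable P ?I" "integrable Q ?I"
    using XP XQ
    by (auto intro!: P.integrable_const_bound[of _ 1] Q.integrable_const_bound[of _ 1]
        split: split_indicator)
  have le: "integral\<^sup>L P X - \<kappa> * integral\<^sup>L Q X \<le> integral\<^sup>L P ?I - \<kappa> * integral\<^sup>L Q ?I"
  proof (rule field_le_epsilon)
    fix e :: real assume e: "0 < e"
    \<comment> \<open>The \<open>Q\<close>-error is multiplied by the absolute value of \<kappa> and
      added to the \<open>P\<close>-error, so the total is \<open>e\<close>.\<close>
    let ?e = "e / (1 + \<bar>\<kappa>\<bar>)"
    have "0 < ?e" using e by simp
    then obtain f where f: "continuous_on UNIV f" "\<And>\<omega>. 0 \<le> f \<omega> \<and> f \<omega> \<le> 1"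
        "(\<integral>\<omega>. \<bar>f \<omega> - ?I \<omega>\<bar> \<partial>P) < ?e" "(\<integral>\<omega>. \<bar>f \<omega> - ?I \<omega>\<bar> \<partial>Q) < ?e"
      using continuous_approx_indicator[OF P.finite_measure_axioms sets_P Q.finite_measure_axioms sets_Q A]
      by blast
    have [measurable]: "f \<in> borel_measurable borel" using f(1) by (rule borel_measurable_continuous_onI)
    have fint: "integrable P f" "integrable Q f"
      using f(2) by (auto intro!: P.integrable_const_bound[of _ 1] Q.integrable_const_bound[of _ 1])
    have "\<bar>integral\<^sup>L P f - integral\<^sup>L P ?I\<bar> < ?e"
      using f(3) integral_abs_bound[of P "\<lambda>\<omega>. f \<omega> - ?I \<omega>"] fint int by simp
    moreover have "\<bar>integral\<^sup>L Q f - integral\<^sup>L Q ?I\<bar> < ?e"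
      using f(4) integral_abs_bound[of Q "\<lambda>\<omega>. f \<omega> - ?I \<omega>"] fint int by simp
    then have "\<bar>\<kappa> * (integral\<^sup>L Q f - integral\<^sup>L Q ?I)\<bar> \<le> \<bar>\<kappa>\<bar> * ?e"
      unfolding abs_mult by (intro mult_left_mono) auto
    moreover have "?e + \<bar>\<kappa>\<bar> * ?e = e"
    proof -
      have "?e + \<bar>\<kappa>\<bar> * ?e = (1 + \<bar>\<kappa>\<bar>) * ?e" by (simp only: distrib_right mult_1)
      then show ?thesis by simp
    qed
    ultimately have "integral\<^sup>L P f - \<kappa> * integral\<^sup>L Q f \<le> integral\<^sup>L P ?I - \<kappa> * integral\<^sup>L Q ?I + e"
      unfolding right_diff_distrib by linarith
    then show "integral\<^sup>L P X - \<kappa> * integral\<^sup>L Q X \<le> integral\<^sup>L P ?I - \<kappa> * integral\<^sup>L Q ?I + e"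
      using opt[OF f(1,2)] by linarith
  qed
  let ?u = "\<lambda>\<omega>. (\<kappa> * H \<omega> - G \<omega>) * (?I \<omega> - X \<omega>)"
  have KX: "AE \<omega> in K. 0 \<le> X \<omega> \<and> X \<omega> \<le> 1" by (rule AE_K_I[OF XP XQ])
  then have u0: "AE \<omega> in K. 0 \<le> ?u \<omega>"
  proof eventually_elim
    case (elim \<omega>)
    show ?case
    proof (cases "\<omega> \<in> ?A")
      case True
      then show ?thesis using elim by (intro mult_nonneg_nonneg) auto
    next
      case False
      then show ?thesis using elim by (intro mult_nonpos_nonpos) auto
    qed
  qed
  \<comment> \<open>Expanded into the four products whose integrals are expectations under
    \<open>P\<close> and \<open>Q\<close>.\<close>
  have [simp]: "?u = (\<lambda>\<omega>. \<kappa> * (H \<omega> * ?I \<omega>) - \<kappa> * (H \<omega> * X \<omega>) - (G \<omega> * ?I \<omega> - G \<omega> * X \<omega>))"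
    by (simp add: fun_eq_iff algebra_simps)
  have ints: "integrable K (\<lambda>\<omega>. H \<omega> * ?I \<omega>)" "integrable K (\<lambda>\<omega>. H \<omega> * X \<omega>)"
      "integrable K (\<lambda>\<omega>. G \<omega> * ?I \<omega>)" "integrable K (\<lambda>\<omega>. G \<omega> * X \<omega>)"
    using int integral_Q(2)[of ?I] integral_Q(2)[of X] integral_P(2)[of ?I] integral_P(2)[of X] by auto
  then have uint: "integrable K ?u" by simp
  have "integral\<^sup>L K ?u = \<kappa> * integral\<^sup>L Q ?I - \<kappa> * integral\<^sup>L Q X - (integral\<^sup>L P ?I - integral\<^sup>L P X)"
    using ints integral_Q(1)[of ?I] integral_Q(1)[of X] integral_P(1)[of ?I] integral_P(1)[of X] by simp
  then have "integral\<^sup>L K ?u \<le> 0" using le by linarith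
  then have "integral\<^sup>L K ?u = 0" using integral_nonneg_AE[OF u0] by linarith
  then have "AE \<omega> in K. ?u \<omega> = 0" using integral_nonneg_eq_0_iff_AE[OF uint u0] by simp
  then show ?thesis using KX
  proof eventually_elim
    case (elim \<omega>)
    then have "(\<kappa> * H \<omega> - G \<omega>) * (?I \<omega> - X \<omega>) = 0" by (simp add: algebra_simps)
    then have "\<kappa> * H \<omega> = G \<omega> \<or> X \<omega> = ?I \<omega>" by auto
    then show ?case using elim
      by (auto simp: threshold_test_def indicator_def)
  qed
qed

text \<open>Since \<open>Q\<close> has density \<open>H\<close>, a \<open>Q\<close>-a.s. property
  holds \<open>K\<close>-a.e. on \<open>{H > 0}\<close>, giving \<open>X = 1\<close> there; on
  \<open>{H = 0}\<close> the clipped \<open>X\<close> is the randomisation.\<close>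

lemma threshold_test_infinite:
  assumes XP: "AE \<omega> in P. 0 \<le> X \<omega> \<and> X \<omega> \<le> 1" and XQ: "AE \<omega> in Q. X \<omega> = 1"
  shows "AE \<omega> in K. X \<omega> = threshold_test \<infinity> H G (\<lambda>\<omega>. max 0 (min 1 (X \<omega>))) \<omega>"
proof -
  have "AE \<omega> in density K (\<lambda>\<omega>. ennreal (H \<omega>)). X \<omega> = 1"
    using XQ by (subst density_H[symmetric])
  then have "AE \<omega> in K. 0 < ennreal (H \<omega>) \<longrightarrow> X \<omega> = 1" by (subst (asm) AE_density) auto
  moreover have "AE \<omega> in K. 0 \<le> X \<omega> \<and> X \<omega> \<le> 1"
    by (rule AE_K_I[OF XP]) (use XQ in \<open>auto elim: eventually_mono\<close>)
  ultimately show ?thesis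
  proof eventually_elim
    case (elim \<omega>)
    have "0 \<le> H \<omega>" by simp
    then consider "H \<omega> = 0" | "0 < H \<omega>" by linarith
    then show ?case
      using elim by cases (auto simp: threshold_test_def)
  qed
qed

end

section \<open>Dominated probabilities and optimal tests\<close>

text \<open>An open \<open>U\<close> is the set where the truncated distance to its complement is
  positive, so bounded continuous functions already generate the Borel field. Again
  \<open>U = UNIV\<close> is separate because of the convention for \<open>infdist\<close>.\<close>

lemma sigma_sets_superlevels_eq_borel:
  fixes L :: "('a::metric_space \<Rightarrow> real) set"
  assumes L: "bcontfun \<subseteq> L" "L \<subseteq> borel_measurable borel"
  shows "sigma_sets UNIV {{\<omega>. t < f \<omega>} |f t. f \<in> L} = sets borel"
proof
  have "{\<omega>. t < f \<omega>} \<in> sets borel" if "f \<in> L" for f t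
    using that L(2) by (auto intro: borel_measurable_less simp: subset_iff)
  then have "sigma_sets (space borel) {{\<omega>. t < f \<omega>} |f t. f \<in> L} \<subseteq> sets borel"
    by (intro sets.sigma_sets_subset) auto
  then show "sigma_sets UNIV {{\<omega>. t < f \<omega>} |f t. f \<in> L} \<subseteq> sets borel" by simp
  have "U \<in> {{\<omega>. t < f \<omega>} |f t. f \<in> L}" if U: "open U" for U :: "'a set"
  proof -
    define f where "f \<omega> = (if U = UNIV then 1 else min 1 (infdist \<omega> (- U)))" for \<omega>
    have "continuous_on UNIV f"
      unfolding f_def by (cases "U = UNIV") (auto intro!: continuous_intros)
    moreover have "\<bar>f \<omega>\<bar> \<le> 1" for \<omega> by (auto simp: f_def infdist_nonneg)
    ultimately have "f \<in> bcontfun" by (auto simp: bcontfun_def bounded_iff)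
    moreover have "U = {\<omega>. 0 < f \<omega>}"
    proof (cases "U = UNIV")
      case False
      have "closed (- U)" "- U \<noteq> {}" using False U by auto
      then have "\<omega> \<in> U \<longleftrightarrow> 0 < infdist \<omega> (- U)" for \<omega>
        using in_closed_iff_infdist_zero[of "- U" \<omega>] infdist_nonneg[of \<omega> "- U"] by auto
      then show ?thesis using False by (auto simp: f_def)
    qed (simp add: f_def)
    ultimately show ?thesis using L(1) by blast
  qed
  then have "{U::'a set. open U} \<subseteq> {{\<omega>. t < f \<omega>} |f t. f \<in> L}" by blast
  then show "sets borel \<subseteq> sigma_sets UNIV {{\<omega>. t < f \<omega>} |f t. f \<in> L}"
    unfolding sets_borel by (rule sigma_sets_mono')
qed

text \<open>Integrability is demanded explicitly: the integral of a non-integrable function is 0 by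
  default, and the inequality alone would then say nothing.\<close>

definition dominated_probability ::
    "(('a::topological_space \<Rightarrow> real) \<Rightarrow> real) \<Rightarrow> (('a \<Rightarrow> real) \<Rightarrow> real) \<Rightarrow> 'a measure \<Rightarrow> bool" where
  "dominated_probability \<rho> \<phi> Q \<longleftrightarrow> prob_space Q \<and> sets Q = sets borel \<and>
     (\<forall>X\<in>Lc1 \<rho>. integrable Q X \<and> integral\<^sup>L Q X \<le> Lc1_ext \<rho> \<phi> X)"

text \<open>The Daniell integral is built on all of \<^term>\<open>Lc1 \<rho>\<close>, not just on the continuous
  functions: since \<open>\<rho>\<close> is only finitely subadditive, a measure representing a functional on
  \<open>C\<^sub>b\<close> need not be dominated by \<open>\<rho>\<close> on the Borel representatives in \<^term>\<open>Lc1 \<rho>\<close>.\<close>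

theorem exists_dominated_probability:
  fixes \<rho> \<phi> :: "('a::metric_space \<Rightarrow> real) \<Rightarrow> real"
  assumes dom: "dominated_expectation \<rho> \<phi>" and cont: "continuous_from_above \<rho> \<phi>"
    and C: "C \<subseteq> Lc1 \<rho>" "C \<noteq> {}" "convex_functions C"
    and s: "\<And>Y. Y \<in> C \<Longrightarrow> s \<le> Lc1_ext \<rho> \<phi> Y"
  shows "\<exists>Q. dominated_probability \<rho> \<phi> Q \<and> (\<forall>Y\<in>C. s \<le> integral\<^sup>L Q Y)"
proof -
  interpret dominated_expectation \<rho> \<phi> by (rule dom)
  have "\<exists>E. linear_on_functions (Lc1 \<rho>) E \<and> (\<forall>X\<in>Lc1 \<rho>. E X \<le> ext X) \<and> (\<forall>Y\<in>C. s \<le> E Y)"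
    by (rule hahn_banach_convex_set[OF Lc1_function_space ext_sublinear C s])
  then obtain E where E: "linear_on_functions (Lc1 \<rho>) E" "\<forall>X\<in>Lc1 \<rho>. E X \<le> ext X" "\<forall>Y\<in>C. s \<le> E Y"
    by (elim exE conjE)
  have E_minus: "E (\<lambda>\<omega>. - X \<omega>) = - E X" if "X \<in> Lc1 \<rho>" for X
    using E(1) that by (auto simp: linear_on_functions_def dest!: bspec[of _ _ X] spec[of _ "-1"])
  note L_minus = function_space_uminus[OF Lc1_function_space]
  \<comment> \<open>Positivity comes from domination:
    \<open>- E X = E (- X) \<le> ext (- X) \<le> 0\<close>.\<close>
  have E_nonneg: "0 \<le> E X" if "X \<in> Lc1 \<rho>" "\<And>\<omega>. 0 \<le> X \<omega>" for X
  proof -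
    have "- E X \<le> ext (\<lambda>\<omega>. - X \<omega>)" using E(2) E_minus L_minus that(1) by metis
    also have "\<dots> \<le> ext (\<lambda>_. 0)" using that by (intro ext_mono L_minus Lc1_const) auto
    finally show ?thesis by (simp add: ext_const)
  qed
  interpret D: daniell "Lc1 \<rho>" E
  proof
    fix F :: "nat \<Rightarrow> 'a \<Rightarrow> real"
    assume F: "\<And>n. F n \<in> Lc1 \<rho>" "\<And>\<omega>. decseq (\<lambda>n. F n \<omega>)" "\<And>\<omega>. (\<lambda>n. F n \<omega>) \<longlonglongrightarrow> 0"
    have "quasi_surely \<rho> (\<lambda>\<omega>. decseq (\<lambda>n. F n \<omega>) \<and> (\<lambda>n. F n \<omega>) \<longlonglongrightarrow> 0)"
      using F(2,3) by (intro quasi_surelyI) auto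
    then have lim: "(\<lambda>n. ext (F n)) \<longlonglongrightarrow> 0"
      using cont F(1) unfolding continuous_from_above_def by blast
    have "0 \<le> E (F n)" for n
      using decseq_ge[OF F(2,3)] by (intro E_nonneg F(1)) auto
    moreover have "E (F n) \<le> ext (F n)" for n using E(2) F(1) by blast
    ultimately show "(\<lambda>n. E (F n)) \<longlonglongrightarrow> 0"
      by (intro tendsto_sandwich[OF _ _ tendsto_const lim]) auto
  qed (use Lc1_function_space Lc1_const Lc1_abs E(1) E_nonneg in auto)
  have sets: "sets D.\<mu> = sets borel"
    unfolding D.sets_mu D.\<S>_def
    by (rule sigma_sets_superlevels_eq_borel) (auto intro: bcontfun_Lc1 Lc1_measurable)
  \<comment> \<open>Domination at the constants 1 and -1 bounds the total mass from both
    sides.\<close>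
  have "E (\<lambda>_. 1) = 1"
    using bspec[OF E(2) Lc1_const[of 1]] bspec[OF E(2) Lc1_const[of "-1"]] E_minus[OF Lc1_const[of 1]]
    by (simp add: ext_const)
  then have "prob_space D.\<mu>"
    using D.finite_measure_mu D.measure_mu_UNIV
    by (intro prob_spaceI) (simp add: finite_measure.emeasure_eq_measure D.space_mu)
  then have "dominated_probability \<rho> \<phi> D.\<mu>"
    using sets D.integral_mu E(2) by (simp add: dominated_probability_def)
  moreover have "\<forall>Y\<in>C. s \<le> integral\<^sup>L D.\<mu> Y" using D.integral_mu(2) E(3) C(1) by auto
  ultimately show ?thesis by blast
qed

context dominated_expectation
begin

text \<open>Polar sets are null for \<open>Q\<close>, because their indicators lie in
  \<open>Lc1\<close> with extension 0. This turns quasi-sure bounds on tests into almost sure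
  ones.\<close>

lemma dominated_probability_AE:
  assumes Q: "dominated_probability \<rho> \<phi> Q" and qs: "quasi_surely \<rho> \<psi>"
  shows "AE \<omega> in Q. \<psi> \<omega>"
proof -
  interpret prob_space Q using Q by (simp add: dominated_probability_def)
  have sets: "sets Q = sets borel" using Q by (simp add: dominated_probability_def)
  obtain N where N: "polar \<rho> N" "\<And>\<omega>. \<omega> \<notin> N \<Longrightarrow> \<psi> \<omega>" using qs by (auto simp: quasi_surely_def)
  then have NQ: "N \<in> sets Q" using sets by (simp add: polar_def)
  have "integral\<^sup>L Q (indicat_real N) \<le> 0"
    using Q polar_Lc1(1)[OF N(1)] ext_polar[OF N(1)] by (auto simp: dominated_probability_def)
  then have "measure Q N = 0"
    using NQ sets.sets_into_space[OF NQ] by (simp add: measure_le_0_iff Int_absorb2)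
  then have "N \<in> null_sets Q" using NQ by (auto simp: null_sets_def emeasure_eq_measure)
  then show ?thesis by (rule AE_I') (use N(2) in auto)
qed

lemma polar_Un: assumes "polar \<rho> A" "polar \<rho> B" shows "polar \<rho> (A \<union> B)"
proof -
  have AB: "indicator A \<in> bounded_borel" "indicator B \<in> bounded_borel" "indicator (A \<union> B) \<in> bounded_borel"
    using assms by (auto simp: polar_def intro!: bounded_borel_indicator)
  have "\<rho> (indicator (A \<union> B)) \<le> \<rho> (\<lambda>\<omega>. indicator A \<omega> + indicator B \<omega>)"
    by (intro mono AB bounded_borel_add) (auto split: split_indicator)
  also have "\<dots> \<le> 0" using subadd[OF AB(1,2)] assms by (simp add: polar_def)
  finally have "\<rho> (indicator (A \<union> B)) \<le> 0" .
  moreover have "\<rho> (\<lambda>_. 0) \<le> \<rho> (indicator (A \<union> B))"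
    by (intro mono AB bounded_borel_const) auto
  ultimately show ?thesis using assms const[of 0] by (auto simp: polar_def)
qed

lemma quasi_surely_conj:
  assumes "quasi_surely \<rho> \<psi>" "quasi_surely \<rho> \<psi>'" shows "quasi_surely \<rho> (\<lambda>\<omega>. \<psi> \<omega> \<and> \<psi>' \<omega>)"
proof -
  obtain A B where "polar \<rho> A" "\<forall>\<omega>. \<omega> \<notin> A \<longrightarrow> \<psi> \<omega>" "polar \<rho> B" "\<forall>\<omega>. \<omega> \<notin> B \<longrightarrow> \<psi>' \<omega>"
    using assms by (auto simp: quasi_surely_def)
  then show ?thesis unfolding quasi_surely_def by (intro exI[of _ "A \<union> B"]) (auto intro: polar_Un)
qed

lemma quasi_surely_mono: "quasi_surely \<rho> \<psi> \<Longrightarrow> (\<And>\<omega>. \<psi> \<omega> \<Longrightarrow> \<psi>' \<omega>) \<Longrightarrow> quasi_surely \<rho> \<psi>'"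
  by (auto simp: quasi_surely_def)

lemma Lc1_combination: "X \<in> Lc1 \<rho> \<Longrightarrow> Y \<in> Lc1 \<rho> \<Longrightarrow> (\<lambda>\<omega>. u * X \<omega> + v * Y \<omega>) \<in> Lc1 \<rho>"
  by (intro function_space_add[OF Lc1_function_space] function_space_scale[OF Lc1_function_space])

lemma randomized_testsD:
  assumes "X \<in> randomized_tests \<rho>"
  shows "X \<in> Lc1 \<rho>" "quasi_surely \<rho> (\<lambda>\<omega>. 0 \<le> X \<omega> \<and> X \<omega> \<le> 1)"
    "quasi_surely \<rho> (\<lambda>\<omega>. 0 \<le> X \<omega>)" "quasi_surely \<rho> (\<lambda>\<omega>. X \<omega> \<le> 1)"
  using assms by (auto simp: randomized_tests_def elim: quasi_surely_mono)

lemma convex_randomized_tests: "convex_functions (randomized_tests \<rho>)"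
  unfolding convex_functions_def
proof (intro ballI allI impI)
  fix X Y u v assume XY: "X \<in> randomized_tests \<rho>" "Y \<in> randomized_tests \<rho>"
    and uv: "0 \<le> u" "0 \<le> v" "u + v = (1::real)"
  have "quasi_surely \<rho> (\<lambda>\<omega>. 0 \<le> u * X \<omega> + v * Y \<omega> \<and> u * X \<omega> + v * Y \<omega> \<le> 1)"
    by (rule quasi_surely_mono[OF quasi_surely_conj[OF randomized_testsD(2)[OF XY(1)] randomized_testsD(2)[OF XY(2)]]])
      (use uv in \<open>auto intro: convex_bound_le\<close>)
  then show "(\<lambda>\<omega>. u * X \<omega> + v * Y \<omega>) \<in> randomized_tests \<rho>"
    using XY by (auto simp: randomized_tests_def intro: Lc1_combination)
qed

lemma const_randomized_tests: "0 \<le> c \<Longrightarrow> c \<le> 1 \<Longrightarrow> (\<lambda>_. c) \<in> randomized_tests \<rho>"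
  by (auto simp: randomized_tests_def intro: Lc1_const quasi_surelyI)

lemma ext_combination_le:
  assumes "X \<in> Lc1 \<rho>" "Y \<in> Lc1 \<rho>" "0 \<le> u" "0 \<le> v"
  shows "ext (\<lambda>\<omega>. u * X \<omega> + v * Y \<omega>) \<le> u * ext X + v * ext Y"
proof -
  note scale = function_space_scale[OF Lc1_function_space]
  have "ext (\<lambda>\<omega>. u * X \<omega> + v * Y \<omega>) \<le> ext (\<lambda>\<omega>. u * X \<omega>) + ext (\<lambda>\<omega>. v * Y \<omega>)"
    by (intro sublinear_on_add[OF ext_sublinear] scale assms)
  also have "\<dots> \<le> u * ext X + v * ext Y"
    by (intro add_mono sublinear_on_scale_le[OF ext_sublinear] assms)
  finally show ?thesis .
qed

text \<open>Provides the boundedness that suprema and infima over tests need in the reals.\<close>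

lemma ext_test_bounds:
  assumes X: "X \<in> randomized_tests \<rho>" shows "0 \<le> ext X" "- 1 \<le> ext (\<lambda>\<omega>. - X \<omega>)"
proof -
  note X' = randomized_testsD[OF X]
  show "0 \<le> ext X"
    using ext_mono_quasi_surely[OF Lc1_const[of 0] X'(1) X'(3)] by (simp add: ext_const)
  have "quasi_surely \<rho> (\<lambda>\<omega>. - 1 \<le> - X \<omega>)" using X'(4) by simp
  then show "- 1 \<le> ext (\<lambda>\<omega>. - X \<omega>)"
    using ext_mono_quasi_surely[OF Lc1_const[of "- 1"] function_space_uminus[OF Lc1_function_space X'(1)]]
    by (simp add: ext_const)
qed

end

lemma convex_level_tests:
  assumes "dominated_expectation \<rho> \<phi>" shows "convex_functions (level_tests \<rho> \<phi> \<alpha>)"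
  unfolding convex_functions_def
proof (intro ballI allI impI)
  interpret dominated_expectation \<rho> \<phi> by (rule assms)
  fix X Y u v assume XY: "X \<in> level_tests \<rho> \<phi> \<alpha>" "Y \<in> level_tests \<rho> \<phi> \<alpha>"
    and uv: "0 \<le> u" "0 \<le> v" "u + v = (1::real)"
  have "ext (\<lambda>\<omega>. u * X \<omega> + v * Y \<omega>) \<le> u * ext X + v * ext Y"
    using XY uv by (intro ext_combination_le) (auto simp: level_tests_def dest: randomized_testsD(1))
  also have "\<dots> \<le> \<alpha>" using XY uv by (intro convex_bound_le) (auto simp: level_tests_def)
  finally show "(\<lambda>\<omega>. u * X \<omega> + v * Y \<omega>) \<in> level_tests \<rho> \<phi> \<alpha>"
    using XY uv convex_randomized_tests by (simp add: level_tests_def convex_functions_def)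
qed

lemma max_expectation_sublinear:
  fixes \<rho>\<^sub>1 \<rho>\<^sub>2 :: "('a::topological_space \<Rightarrow> real) \<Rightarrow> real"
  assumes "sublinear_expectation \<rho>\<^sub>1" "sublinear_expectation \<rho>\<^sub>2"
  shows "sublinear_expectation (max_expectation \<rho>\<^sub>1 \<rho>\<^sub>2)"
proof -
  interpret r1: sublinear_expectation_on \<rho>\<^sub>1 by standard (rule assms)
  interpret r2: sublinear_expectation_on \<rho>\<^sub>2 by standard (rule assms)
  show ?thesis
    unfolding sublinear_expectation_def max_expectation_def
  proof (intro conjI ballI allI impI)
    fix X :: "'a \<Rightarrow> real" assume X: "X \<in> bounded_borel"
    show "max (\<rho>\<^sub>1 (\<lambda>\<omega>. l * X \<omega>)) (\<rho>\<^sub>2 (\<lambda>\<omega>. l * X \<omega>)) = l * max (\<rho>\<^sub>1 X) (\<rho>\<^sub>2 X)" if "0 \<le> l" for l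
      using that by (simp add: r1.scale[OF X] r2.scale[OF X] max_mult_distrib_left)
    fix Y :: "'a \<Rightarrow> real" assume Y: "Y \<in> bounded_borel"
    show "max (\<rho>\<^sub>1 (\<lambda>\<omega>. X \<omega> + Y \<omega>)) (\<rho>\<^sub>2 (\<lambda>\<omega>. X \<omega> + Y \<omega>)) \<le> max (\<rho>\<^sub>1 X) (\<rho>\<^sub>2 X) + max (\<rho>\<^sub>1 Y) (\<rho>\<^sub>2 Y)"
      using r1.subadd[OF X Y] r2.subadd[OF X Y] by linarith
    show "max (\<rho>\<^sub>1 X) (\<rho>\<^sub>2 X) \<le> max (\<rho>\<^sub>1 Y) (\<rho>\<^sub>2 Y)" if "\<forall>\<omega>. X \<omega> \<le> Y \<omega>"
      using that r1.mono[OF X Y] r2.mono[OF X Y] by (intro max.mono) auto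
  qed (simp_all add: r1.const r2.const)
qed

text \<open>Lagrange multiplier for a planar set given by two functions: \<open>\<kappa>\<close> is a slope between
  the chords to the left and to the right of \<open>(b, a)\<close>.\<close>

lemma exists_separating_slope:
  fixes p q :: "'b \<Rightarrow> real"
  assumes eq: "\<And>y. y \<in> R \<Longrightarrow> q y = b \<Longrightarrow> a \<le> p y"
    and cross: "\<And>y w. y \<in> R \<Longrightarrow> w \<in> R \<Longrightarrow> q y < b \<Longrightarrow> b < q w \<Longrightarrow>
      0 \<le> (q w - b) * (p y - a) + (b - q y) * (p w - a)"
    and y0: "y0 \<in> R" "q y0 < b" and w0: "w0 \<in> R" "b < q w0"
  shows "\<exists>\<kappa>. \<forall>y\<in>R. a - \<kappa> * b \<le> p y - \<kappa> * q y"
proof -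
  let ?l = "\<lambda>y. (a - p y) / (b - q y)" and ?S = "{y \<in> R. q y < b}"
  \<comment> \<open>\<open>cross\<close> says, with denominators cleared, that the chord from a left
    point to a right point passes above \<open>(b, a)\<close>; hence left slopes are below right
    slopes.\<close>
  have slopes: "?l y \<le> (p w - a) / (q w - b)" if "y \<in> R" "q y < b" "w \<in> R" "b < q w" for y w
  proof -
    have "(a - p y) * (q w - b) \<le> (p w - a) * (b - q y)"
      using cross[of y w] that by (simp add: algebra_simps)
    then show ?thesis using that by (simp add: divide_le_eq le_divide_eq mult.commute)
  qed
  \<comment> \<open>\<open>w0\<close> bounds the left slopes and \<open>y0\<close> makes their set
    nonempty, so this supremum is meaningful.\<close>
  define \<kappa> where "\<kappa> = (SUP y\<in>?S. ?l y)"
  have bdd: "bdd_above (?l ` ?S)" using slopes[OF _ _ w0] by (intro bdd_aboveI2) auto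
  have "a - \<kappa> * b \<le> p y - \<kappa> * q y" if y: "y \<in> R" for y
  proof -
    consider "q y < b" | "q y = b" | "b < q y" by linarith
    then show ?thesis
    proof cases
      case 1
      then have "?l y \<le> \<kappa>" unfolding \<kappa>_def using y by (intro cSUP_upper bdd) auto
      then show ?thesis using 1 by (simp add: divide_le_eq algebra_simps)
    next
      case 2
      then show ?thesis using eq[OF y] by simp
    next
      case 3
      have "\<kappa> \<le> (p y - a) / (q y - b)"
        unfolding \<kappa>_def using slopes[OF _ _ y 3] y0 by (intro cSUP_least) auto
      then show ?thesis using 3 by (simp add: le_divide_eq algebra_simps)
    qed
  qed
  then show ?thesis by blast
qed

theorem theorem4p7:
  fixes \<rho>\<^sub>1 \<rho>\<^sub>2 \<rho> :: "('a::polish_space \<Rightarrow> real) \<Rightarrow> real" and \<alpha> :: real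
    and T :: "('a \<Rightarrow> real) set"
  defines "\<rho> \<equiv> max_expectation \<rho>\<^sub>1 \<rho>\<^sub>2"
    and "T \<equiv> level_tests \<rho> \<rho>\<^sub>1 \<alpha>"
  assumes "sublinear_expectation \<rho>\<^sub>1" and "sublinear_expectation \<rho>\<^sub>2"
    and "continuous_from_above \<rho> \<rho>\<^sub>1" and "continuous_from_above \<rho> \<rho>\<^sub>2"
    and "0 < \<alpha>" and "\<alpha> < 1"
    and "\<exists>X\<^sub>0\<in>T. Lc1_ext \<rho> (conjugate \<rho>\<^sub>2) X\<^sub>0 = (SUP X\<in>T. Lc1_ext \<rho> (conjugate \<rho>\<^sub>2) X)"
  shows "\<exists>Q P :: 'a measure.
    prob_space Q \<and> sets Q = sets borel \<and> prob_space P \<and> sets P = sets borel \<and>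
    ((\<forall>X\<in>Lc1 \<rho>. integrable Q X \<and> integral\<^sup>L Q X \<le> Lc1_ext \<rho> \<rho>\<^sub>2 X) \<and>
     (SUP X\<in>T. integral\<^sup>L Q X) = (SUP X\<in>T. Lc1_ext \<rho> (conjugate \<rho>\<^sub>2) X)) \<and>
    ((\<forall>X\<in>Lc1 \<rho>. integrable P X \<and> integral\<^sup>L P X \<le> Lc1_ext \<rho> \<rho>\<^sub>1 X) \<and>
     (let \<gamma> = (SUP X\<in>T. integral\<^sup>L Q X); Y' = power_tests \<rho> Q \<gamma> in
       (\<forall>X\<in>T. Lc1_ext \<rho> \<rho>\<^sub>1 X < \<alpha> \<longrightarrow> integral\<^sup>L Q X < \<gamma>) \<longrightarrow>
       (INF Y\<in>Y'. integral\<^sup>L P Y) = (INF Y\<in>Y'. Lc1_ext \<rho> \<rho>\<^sub>1 Y))) \<and>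
    (\<forall>X\<in>T. Lc1_ext \<rho> (conjugate \<rho>\<^sub>2) X = (SUP Z\<in>T. Lc1_ext \<rho> (conjugate \<rho>\<^sub>2) Z) \<longrightarrow>
      (let K = mean_measure P Q;
           H = (\<lambda>\<omega>. enn2real (RN_deriv K Q \<omega>));
           G = (\<lambda>\<omega>. enn2real (RN_deriv K P \<omega>)) in
       \<exists>\<kappa>::ereal. \<exists>B\<in>borel_measurable borel.
         \<kappa> \<noteq> -\<infinity> \<and> (\<forall>\<omega>. 0 \<le> B \<omega> \<and> B \<omega> \<le> 1) \<and>
         (AE \<omega> in K. X \<omega> = threshold_test \<kappa> H G B \<omega>)))"
proof -
  have sub: "sublinear_expectation \<rho>" unfolding \<rho>_def by (rule max_expectation_sublinear) fact+
  have dom1: "dominated_expectation \<rho> \<rho>\<^sub>1" and dom2: "dominated_expectation \<rho> \<rho>\<^sub>2"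
    using sub assms(3,4)
    by (auto simp: dominated_expectation_def dominated_expectation_axioms_def
        sublinear_expectation_on_def \<rho>_def max_expectation_def)
  interpret e1: dominated_expectation \<rho> \<rho>\<^sub>1 by (rule dom1)
  interpret e2: dominated_expectation \<rho> \<rho>\<^sub>2 by (rule dom2)
  let ?R = "randomized_tests \<rho>"
  define \<beta> where "\<beta> = (SUP X\<in>T. Lc1_ext \<rho> (conjugate \<rho>\<^sub>2) X)"
  note R = e1.randomized_testsD
  have TR: "X \<in> ?R" and T_level: "e1.ext X \<le> \<alpha>" if "X \<in> T" for X
    using that by (auto simp: T_def level_tests_def)
  have TI: "X \<in> T" if "X \<in> ?R" "e1.ext X \<le> \<alpha>" for X
    using that by (auto simp: T_def level_tests_def)
  \<comment> \<open>This constant test makes \<open>T\<close> nonempty and, through its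
    \<open>Q\<close>-power \<alpha>, will give \<beta> > 0.\<close>
  have \<alpha>T: "(\<lambda>_. \<alpha>) \<in> T"
    using assms(7,8) by (intro TI e1.const_randomized_tests) (auto simp: e1.ext_const)
  have conj: "Lc1_ext \<rho> (conjugate \<rho>\<^sub>2) X = - e2.ext (\<lambda>\<omega>. - X \<omega>)" if "X \<in> T" for X
    by (rule e2.ext_conjugate) (use R TR that in auto)
  have conj_le_1: "Lc1_ext \<rho> (conjugate \<rho>\<^sub>2) X \<le> 1" if "X \<in> T" for X
    using conj[OF that] e2.ext_test_bounds(2)[OF TR[OF that]] by simp
  have conj_le_\<beta>: "Lc1_ext \<rho> (conjugate \<rho>\<^sub>2) X \<le> \<beta>" if "X \<in> T" for X
    unfolding \<beta>_def by (rule cSUP_upper[OF that]) (rule bdd_aboveI2[OF conj_le_1])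
  have \<beta>_le_1: "\<beta> \<le> 1" unfolding \<beta>_def using \<alpha>T conj_le_1 by (intro cSUP_least) auto

  \<comment> \<open>The measure \<open>Q\<close> and equality of the two suprema\<close>
  let ?C = "(\<lambda>X \<omega>. - X \<omega>) ` T"
  have "convex_functions ?C"
    unfolding convex_functions_def
  proof (intro ballI allI impI)
    fix X' Y' u v assume "X' \<in> ?C" "Y' \<in> ?C" and uv: "0 \<le> u" "0 \<le> v" "u + v = (1::real)"
    then obtain X Y where XY: "X \<in> T" "Y \<in> T" and eq: "X' = (\<lambda>\<omega>. - X \<omega>)" "Y' = (\<lambda>\<omega>. - Y \<omega>)" by auto
    have "(\<lambda>\<omega>. u * X \<omega> + v * Y \<omega>) \<in> T"
      using convex_level_tests[OF dom1] XY uv by (simp add: T_def convex_functions_def)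
    moreover have "(\<lambda>\<omega>. u * X' \<omega> + v * Y' \<omega>) = (\<lambda>\<omega>. - (u * X \<omega> + v * Y \<omega>))" by (simp add: eq)
    ultimately show "(\<lambda>\<omega>. u * X' \<omega> + v * Y' \<omega>) \<in> ?C"
      using imageI[of "\<lambda>\<omega>. u * X \<omega> + v * Y \<omega>" T "\<lambda>X \<omega>. - X \<omega>"] by simp
  qed
  moreover have "- \<beta> \<le> e2.ext Y" if "Y \<in> ?C" for Y using that conj conj_le_\<beta> by fastforce
  moreover have "?C \<subseteq> Lc1 \<rho>"
    using R(1)[OF TR] function_space_uminus[OF e1.Lc1_function_space] by auto
  ultimately obtain Q where Q: "dominated_probability \<rho> \<rho>\<^sub>2 Q" "\<forall>Y\<in>?C. - \<beta> \<le> integral\<^sup>L Q Y"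
    using exists_dominated_probability[OF dom2 assms(6), of ?C "- \<beta>"] \<alpha>T by blast
  have Q': "prob_space Q" "sets Q = sets borel" "\<And>X. X \<in> Lc1 \<rho> \<Longrightarrow> integrable Q X"
    "\<And>X. X \<in> Lc1 \<rho> \<Longrightarrow> integral\<^sup>L Q X \<le> e2.ext X"
    using Q(1) by (auto simp: dominated_probability_def)
  interpret Q: prob_space Q by (rule Q')
  have Q_le_\<beta>: "integral\<^sup>L Q X \<le> \<beta>" if "X \<in> T" for X using Q(2) that by auto
  have conj_le_Q: "Lc1_ext \<rho> (conjugate \<rho>\<^sub>2) X \<le> integral\<^sup>L Q X" if "X \<in> T" for X
    using Q'(4)[OF function_space_uminus[OF e1.Lc1_function_space R(1)[OF TR[OF that]]]] conj[OF that] by simp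
  have \<gamma>: "(SUP X\<in>T. integral\<^sup>L Q X) = \<beta>"
  proof (rule antisym)
    show "(SUP X\<in>T. integral\<^sup>L Q X) \<le> \<beta>" using \<alpha>T Q_le_\<beta> by (intro cSUP_least) auto
    show "\<beta> \<le> (SUP X\<in>T. integral\<^sup>L Q X)"
      unfolding \<beta>_def using \<alpha>T conj_le_Q Q_le_\<beta> by (intro cSUP_mono bdd_aboveI2[of _ _ \<beta>]) auto
  qed
  have Q_lin: "integral\<^sup>L Q (\<lambda>\<omega>. u * X \<omega> + v * Y \<omega>) = u * integral\<^sup>L Q X + v * integral\<^sup>L Q Y"
    if "X \<in> ?R" "Y \<in> ?R" for X Y u v
    using Q'(3)[OF R(1)[OF that(1)]] Q'(3)[OF R(1)[OF that(2)]] by simp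

  \<comment> \<open>The measure \<open>P\<close> and equality of the two infima\<close>
  let ?Y = "power_tests \<rho> Q \<beta>"
  define c where "c = (INF Y\<in>?Y. e1.ext Y)"
  have YR: "Y \<in> ?R" and Y_power: "\<beta> \<le> integral\<^sup>L Q Y" if "Y \<in> ?Y" for Y
    using that by (auto simp: power_tests_def)
  have YI: "Y \<in> ?Y" if "Y \<in> ?R" "\<beta> \<le> integral\<^sup>L Q Y" for Y
    using that by (auto simp: power_tests_def)
  \<comment> \<open>Nonemptiness of \<open>?Y\<close>, from \<beta> \<le> 1.\<close>
  have oneY: "(\<lambda>_. 1) \<in> ?Y"
    using \<beta>_le_1 by (intro YI e1.const_randomized_tests) (auto simp: Q.prob_space)
  have c_le: "c \<le> e1.ext Y" if "Y \<in> ?Y" for Y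
    unfolding c_def by (rule cINF_lower[OF _ that])
      (rule bdd_belowI2[OF e1.ext_test_bounds(1)[OF YR]])
  have "convex_functions ?Y"
    unfolding convex_functions_def
  proof (intro ballI allI impI YI)
    fix X Y u v assume XY: "X \<in> ?Y" "Y \<in> ?Y" and uv: "0 \<le> u" "0 \<le> v" "u + v = (1::real)"
    show "(\<lambda>\<omega>. u * X \<omega> + v * Y \<omega>) \<in> ?R"
      using e1.convex_randomized_tests YR[OF XY(1)] YR[OF XY(2)] uv unfolding convex_functions_def by blast
    \<comment> \<open>Negated because \<open>convex_bound_le\<close> yields upper bounds
      only.\<close>
    have "- (u * integral\<^sup>L Q X + v * integral\<^sup>L Q Y) \<le> - \<beta>"
      using convex_bound_le[of "- integral\<^sup>L Q X" "- \<beta>" "- integral\<^sup>L Q Y" u v] Y_power[OF XY(1)] Y_power[OF XY(2)] uv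
      by simp
    then show "\<beta> \<le> integral\<^sup>L Q (\<lambda>\<omega>. u * X \<omega> + v * Y \<omega>)" by (simp add: Q_lin[OF YR[OF XY(1)] YR[OF XY(2)]])
  qed
  then obtain P where P: "dominated_probability \<rho> \<rho>\<^sub>1 P" "\<forall>Y\<in>?Y. c \<le> integral\<^sup>L P Y"
    using exists_dominated_probability[OF dom1 assms(5), of ?Y c] oneY c_le R(1)[OF YR] by blast
  have P': "prob_space P" "sets P = sets borel" "\<And>X. X \<in> Lc1 \<rho> \<Longrightarrow> integrable P X"
    "\<And>X. X \<in> Lc1 \<rho> \<Longrightarrow> integral\<^sup>L P X \<le> e1.ext X"
    using P(1) by (auto simp: dominated_probability_def)
  interpret P: prob_space P by (rule P')
  have P_lin: "integral\<^sup>L P (\<lambda>\<omega>. u * X \<omega> + v * Y \<omega>) = u * integral\<^sup>L P X + v * integral\<^sup>L P Y"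
    if "X \<in> ?R" "Y \<in> ?R" for X Y u v
    using P'(3)[OF R(1)[OF that(1)]] P'(3)[OF R(1)[OF that(2)]] by simp
  interpret PQ: two_probabilities P Q by standard (rule P' Q')+

  have INF_eq: "(INF Y\<in>?Y. integral\<^sup>L P Y) = (INF Y\<in>?Y. e1.ext Y)"
  proof (rule antisym)
    show "(INF Y\<in>?Y. integral\<^sup>L P Y) \<le> (INF Y\<in>?Y. e1.ext Y)"
      using oneY P(2) P'(4) R(1)[OF YR] by (intro cINF_mono bdd_belowI2[of _ c]) auto
    show "(INF Y\<in>?Y. e1.ext Y) \<le> (INF Y\<in>?Y. integral\<^sup>L P Y)"
      unfolding c_def[symmetric] using oneY P(2) by (intro cINF_greatest) auto
  qed

  \<comment> \<open>The threshold form of an optimal test\<close>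
  have form: "\<exists>\<kappa>::ereal. \<exists>B\<in>borel_measurable borel. \<kappa> \<noteq> -\<infinity> \<and> (\<forall>\<omega>. 0 \<le> B \<omega> \<and> B \<omega> \<le> 1) \<and>
      (AE \<omega> in PQ.K. X \<omega> = threshold_test \<kappa> PQ.H PQ.G B \<omega>)"
    if X: "X \<in> T" and opt: "Lc1_ext \<rho> (conjugate \<rho>\<^sub>2) X = \<beta>" for X
  proof -
    let ?B = "\<lambda>\<omega>. max 0 (min 1 (X \<omega>))"
    note XR = TR[OF X]
    have Xm [measurable]: "X \<in> borel_measurable borel" by (rule e1.Lc1_measurable[OF R(1)[OF XR]])
    have XP: "AE \<omega> in P. 0 \<le> X \<omega> \<and> X \<omega> \<le> 1" by (rule e1.dominated_probability_AE[OF P(1) R(2)[OF XR]])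
    have XQ: "AE \<omega> in Q. 0 \<le> X \<omega> \<and> X \<omega> \<le> 1" by (rule e2.dominated_probability_AE[OF Q(1) R(2)[OF XR]])
    have QX: "integral\<^sup>L Q X = \<beta>" using conj_le_Q[OF X] Q_le_\<beta>[OF X] opt by simp
    have B: "?B \<in> borel_measurable borel" "\<forall>\<omega>. 0 \<le> ?B \<omega> \<and> ?B \<omega> \<le> 1" by auto
    have "\<exists>\<kappa>. \<kappa> \<noteq> -\<infinity> \<and> (AE \<omega> in PQ.K. X \<omega> = threshold_test \<kappa> PQ.H PQ.G ?B \<omega>)"
    proof (cases "\<beta> = 1")
      case True
      have Xint: "integrable Q X" by (rule Q'(3)[OF R(1)[OF XR]])
      then have "(\<integral>\<omega>. 1 - X \<omega> \<partial>Q) = 0" using QX True by (simp add: Q.prob_space)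
      moreover have "AE \<omega> in Q. 0 \<le> 1 - X \<omega>" using XQ by eventually_elim simp
      ultimately have "AE \<omega> in Q. 1 - X \<omega> = 0"
        using Xint by (subst (asm) integral_nonneg_eq_0_iff_AE) auto
      then have "AE \<omega> in Q. X \<omega> = 1" by eventually_elim simp
      from PQ.threshold_test_infinite[OF XP this] show ?thesis by (intro exI[of _ \<infinity>]) simp
    next
      case False
      then have \<beta>1: "\<beta> < 1" using \<beta>_le_1 by simp
      have ext_ge: "\<alpha> \<le> e1.ext Y" if Y: "Y \<in> ?Y" for Y
      proof (rule ccontr)
        text \<open>A test of level below \<open>\<alpha>\<close> could be mixed with the constant test \<open>1\<close> to gain power.\<close>
        assume "\<not> \<alpha> \<le> e1.ext Y"
        then have a: "e1.ext Y < \<alpha>" by simp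
        \<comment> \<open>The weight solves
          \<open>ext Y + \<epsilon> (1 - ext Y) = \<alpha>\<close>, so the mixture uses up the level
          exactly; its power would be at least
          \<open>\<beta> + \<epsilon> (1 - \<beta>)\<close>.\<close>
        define \<epsilon> where "\<epsilon> = (\<alpha> - e1.ext Y) / (1 - e1.ext Y)"
        have \<epsilon>: "0 < \<epsilon>" "\<epsilon> \<le> 1" using a assms(8) by (auto simp: \<epsilon>_def)
        let ?Z = "\<lambda>\<omega>. (1 - \<epsilon>) * Y \<omega> + \<epsilon> * 1"
        have one: "(\<lambda>_. 1) \<in> ?R" by (rule e1.const_randomized_tests) auto
        have ZR: "?Z \<in> ?R"
          using e1.convex_randomized_tests[unfolded convex_functions_def, rule_format, OF YR[OF Y] one, of "1 - \<epsilon>" \<epsilon>] \<epsilon>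
          by simp
        have "e1.ext ?Z \<le> (1 - \<epsilon>) * e1.ext Y + \<epsilon> * e1.ext (\<lambda>_. 1)"
          using \<epsilon> by (intro e1.ext_combination_le R(1)[OF YR[OF Y]] R(1)[OF one]) auto
        also have "\<dots> = e1.ext Y + \<epsilon> * (1 - e1.ext Y)" by (simp add: e1.ext_const algebra_simps)
        also have "\<dots> = \<alpha>" using a assms(8) by (simp add: \<epsilon>_def)
        finally have "?Z \<in> T" using ZR by (intro TI)
        then have "(1 - \<epsilon>) * integral\<^sup>L Q Y + \<epsilon> \<le> \<beta>"
          using Q_le_\<beta> Q_lin[OF YR[OF Y] one, of "1 - \<epsilon>" \<epsilon>] by (fastforce simp: Q.prob_space)
        moreover have "(1 - \<epsilon>) * \<beta> \<le> (1 - \<epsilon>) * integral\<^sup>L Q Y"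
          using \<epsilon> Y_power[OF Y] by (intro mult_left_mono) auto
        moreover have "0 < \<epsilon> * (1 - \<beta>)" using \<epsilon> \<beta>1 by simp
        ultimately show False by (simp add: algebra_simps)
      qed
      have "\<alpha> \<le> c" unfolding c_def using oneY ext_ge by (intro cINF_greatest) auto
      then have P_ge: "\<alpha> \<le> integral\<^sup>L P Y" if "Y \<in> ?Y" for Y using P(2) that by force
      have "X \<in> ?Y" using XR QX by (intro YI) auto
      \<comment> \<open>Squeezed: the lower bound \<alpha> holds on \<open>?Y\<close>, which
        contains \<open>X\<close>, and domination with the level constraint gives the upper
        one.\<close>
      then have PX: "integral\<^sup>L P X = \<alpha>"
        using P_ge P'(4)[OF R(1)[OF XR]] T_level[OF X] by force
      have \<beta>0: "0 < \<beta>" using Q_le_\<beta>[OF \<alpha>T] assms(7) by (simp add: Q.prob_space)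
      have "\<exists>\<kappa>. \<forall>Y\<in>?R. \<alpha> - \<kappa> * \<beta> \<le> integral\<^sup>L P Y - \<kappa> * integral\<^sup>L Q Y"
      proof (rule exists_separating_slope)
        show "\<alpha> \<le> integral\<^sup>L P Y" if "Y \<in> ?R" "integral\<^sup>L Q Y = \<beta>" for Y
          using that by (intro P_ge YI) auto
        show "(\<lambda>_. 0) \<in> ?R" "(\<lambda>_. 1) \<in> ?R" by (auto intro!: e1.const_randomized_tests)
        show "integral\<^sup>L Q (\<lambda>_. 0) < \<beta>" "\<beta> < integral\<^sup>L Q (\<lambda>_. 1)" using \<beta>0 \<beta>1 by (auto simp: Q.prob_space)
        fix Y W assume YW: "Y \<in> ?R" "W \<in> ?R" and q: "integral\<^sup>L Q Y < \<beta>" "\<beta> < integral\<^sup>L Q W"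
        \<comment> \<open>The weights \<open>u\<close> and \<open>v\<close> place the mixture of
          \<open>Y\<close> and \<open>W\<close> at \<open>Q\<close>-power exactly \<beta>, where
          \<open>P_ge\<close> applies; \<open>d\<close> clears the denominators afterwards.\<close>
        define d where "d = integral\<^sup>L Q W - integral\<^sup>L Q Y"
        define u where "u = (integral\<^sup>L Q W - \<beta>) / d"
        define v where "v = (\<beta> - integral\<^sup>L Q Y) / d"
        have d: "0 < d" using q by (simp add: d_def)
        have uv: "0 \<le> u" "0 \<le> v" "u + v = 1" and du: "d * u = integral\<^sup>L Q W - \<beta>" and dv: "d * v = \<beta> - integral\<^sup>L Q Y"
          using d q by (auto simp: u_def v_def add_divide_distrib[symmetric]) (simp add: d_def)
        have "d * (u * integral\<^sup>L Q Y + v * integral\<^sup>L Q W) = d * u * integral\<^sup>L Q Y + d * v * integral\<^sup>L Q W"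
          by (simp add: algebra_simps)
        also have "\<dots> = d * \<beta>" unfolding du dv by (simp add: d_def algebra_simps)
        finally have "u * integral\<^sup>L Q Y + v * integral\<^sup>L Q W = \<beta>" using d by simp
        then have "\<alpha> \<le> integral\<^sup>L P (\<lambda>\<omega>. u * Y \<omega> + v * W \<omega>)"
          using uv YW e1.convex_randomized_tests
          by (intro P_ge YI) (auto simp: Q_lin[OF YW] convex_functions_def)
        then have "\<alpha> \<le> u * integral\<^sup>L P Y + v * integral\<^sup>L P W" by (simp add: P_lin[OF YW])
        then have "d * \<alpha> \<le> d * (u * integral\<^sup>L P Y + v * integral\<^sup>L P W)" using d by simp
        also have "\<dots> = d * u * integral\<^sup>L P Y + d * v * integral\<^sup>L P W" by (simp add: algebra_simps)
        finally show "0 \<le> (integral\<^sup>L Q W - \<beta>) * (integral\<^sup>L P Y - \<alpha>) + (\<beta> - integral\<^sup>L Q Y) * (integral\<^sup>L P W - \<alpha>)"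
          unfolding du dv by (simp add: d_def algebra_simps)
      qed
      then obtain \<kappa> where \<kappa>: "\<forall>Y\<in>?R. \<alpha> - \<kappa> * \<beta> \<le> integral\<^sup>L P Y - \<kappa> * integral\<^sup>L Q Y" by blast
      have "AE \<omega> in PQ.K. X \<omega> = threshold_test (ereal \<kappa>) PQ.H PQ.G ?B \<omega>"
      proof (rule PQ.threshold_test_finite[OF Xm XP XQ])
        fix Y :: "'a \<Rightarrow> real" assume Y: "continuous_on UNIV Y" "\<And>\<omega>. 0 \<le> Y \<omega> \<and> Y \<omega> \<le> 1"
        \<comment> \<open>Continuous tests are randomized tests, so the multiplier inequality covers
          every competitor that \<open>threshold_test_finite\<close> asks about.\<close>
        have "Y \<in> bcontfun" using Y by (auto simp: bcontfun_def bounded_iff intro!: exI[of _ 1])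
        then have "Y \<in> ?R" using Y(2) by (auto simp: randomized_tests_def intro: e1.bcontfun_Lc1 e1.quasi_surelyI)
        then show "integral\<^sup>L P X - \<kappa> * integral\<^sup>L Q X \<le> integral\<^sup>L P Y - \<kappa> * integral\<^sup>L Q Y"
          using \<kappa> by (simp add: PX QX)
      qed
      then show ?thesis by (intro exI[of _ "ereal \<kappa>"]) simp
    qed
    then obtain \<kappa> where "\<kappa> \<noteq> -\<infinity>" "AE \<omega> in PQ.K. X \<omega> = threshold_test \<kappa> PQ.H PQ.G ?B \<omega>"
      by (elim exE conjE)
    then show ?thesis by (intro exI[of _ \<kappa>] bexI[of _ ?B] conjI B)
  qed
  show ?thesis
  proof (rule exI[of _ Q], rule exI[of _ P], unfold \<beta>_def[symmetric] \<gamma> Let_def,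
      intro conjI ballI impI Q' P' refl INF_eq)
    fix X assume "X \<in> T" "Lc1_ext \<rho> (conjugate \<rho>\<^sub>2) X = \<beta>"
    then show "\<exists>\<kappa>::ereal. \<exists>B\<in>borel_measurable borel. \<kappa> \<noteq> -\<infinity> \<and> (\<forall>\<omega>. 0 \<le> B \<omega> \<and> B \<omega> \<le> 1) \<and>
      (AE \<omega> in PQ.K. X \<omega> = threshold_test \<kappa> PQ.H PQ.G B \<omega>)"
      by (rule form)
  qed
qed

end
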